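(* Let $p$ be a prime and let $m\ge 1$ be a fixed integer. For $\gamma\in\mathbb{Z}$, $s\in J_{p;m}$, $a\in I_p$, let $$\theta_{\gamma s a}^{(m)}(x)=p^{-\gamma/2}\,\chi_p\big(s(p^{\gamma}x-a)\big)\,\Omega\big(|p^{\gamma}x-a|_p\big),\qquad x\in\mathbb{Q}_p.$$ Then the functions $$\widetilde\theta_{\gamma s a}^{(m)}(\xi)=F[\theta_{\gamma s a}^{(m)}](\xi)=p^{\gamma/2}\,\chi_p\big(p^{-\gamma}a\,\xi\big)\,\Omega\big(|s+p^{-\gamma}\xi|_p\big),\qquad \xi\in\mathbb{Q}_p,$$ indexed by $\gamma\in\mathbb{Z}$, $s\in J_{p;m}$, $a\in I_p$, form an orthonormal complete basis (i.e. an orthonormal Hilbert-space basis) of $L^2(\mathbb{Q}_p)$.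
   Context: $|\cdot|_p$ is the $p$-adic norm on $\mathbb{Q}_p$. $L^2(\mathbb{Q}_p)$ is the space of complex-valued square-integrable functions on $\mathbb{Q}_p$ with respect to the Haar measure $dx$ normalized so that $\mathbb{Z}_p$ has measure $1$. $\chi_p(x)=e^{2\pi i\{x\}_p}$ for $x\in\mathbb{Q}_p$, where $\{x\}_p$ is the fractional part: $\{x\}_p=0$ if $x\in\mathbb{Z}_p$, and $\{x\}_p=p^{\gamma}(x_0+x_1p+\cdots+x_{|\gamma|-1}p^{|\gamma|-1})$ if $x=p^{\gamma}(x_0+x_1p+x_2p^2+\cdots)$ with $\gamma<0$, $0\le x_j\le p-1$, $x_0\neq 0$. $\Omega(t)=1$ for $0\le t\le 1$ and $\Omega(t)=0$ for $t>1$. The Fourier transform of a locally constant compactly supported function $\varphi:\mathbb{Q}_p\to\mathbb{C}$ is $F[\varphi](\xi)=\int_{\mathbb{Q}_p}\chi_p(\xi x)\varphi(x)\,dx$. $I_p=\{p^{-k}(a_0+a_1p+\cdots+a_{k-1}p^{k-1}) : k\in\mathbb{N},\ a_j\in\{0,1,\dots,p-1\}\}\subset\mathbb{Q}_p$ (a set of representatives of $\mathbb{Q}_p/\mathbb{Z}_p$; $\mathbb{N}$ is the set of positive integers). $J_{p;m}=\{p^{-m}(s_0+s_1p+\cdots+s_{m-1}p^{m-1}) : s_j\in\{0,1,\dots,p-1\},\ s_0\neq 0\}\subset\mathbb{Q}_p$. *)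

theory Defs
  imports "HOL-Analysis.Analysis" "HOL-Computational_Algebra.Squarefree"
    "Berlekamp_Zassenhaus.Finite_Field"
begin

section \<open>The \<open>p\<close>-adic absolute value on the rationals\<close>

definition rat_padic_norm :: "nat \<Rightarrow> rat \<Rightarrow> real" where
  "rat_padic_norm p q = (if q = 0 then 0 else
     real p powi (int (multiplicity (int p) (snd (quotient_of q)))
                  - int (multiplicity (int p) (fst (quotient_of q)))))"

lemma rat_padic_norm_0 [simp]: "rat_padic_norm p 0 = 0"
  by (simp add: rat_padic_norm_def)

lemma rat_padic_norm_frac:
  assumes p: "prime p" and a: "a \<noteq> 0" and b: "b \<noteq> 0"
  shows "rat_padic_norm p (of_int a / of_int b)
    = real p powi (int (multiplicity (int p) b) - int (multiplicity (int p) a))"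
proof -
  obtain c d where cd: "quotient_of (of_int a / of_int b) = (c, d)" by fastforce
  have d: "d > 0" using quotient_of_denom_pos[OF cd] .
  have eq: "(of_int a / of_int b :: rat) = of_int c / of_int d"
    using quotient_of_div[OF cd] .
  then have "(of_int (a * d) :: rat) = of_int (c * b)"
    using b d by (simp add: field_simps)
  then have ad: "a * d = c * b" by (simp only: of_int_eq_iff)
  then have c: "c \<noteq> 0" using a d by auto
  have pp: "prime_elem (int p)" using p by simp
  have "multiplicity (int p) (a * d) = multiplicity (int p) a + multiplicity (int p) d"
    using a d pp by (simp add: prime_elem_multiplicity_mult_distrib)
  moreover have "multiplicity (int p) (c * b) = multiplicity (int p) c + multiplicity (int p) b"
    using c b pp by (simp add: prime_elem_multiplicity_mult_distrib)
  ultimately have "int (multiplicity (int p) b) - int (multiplicity (int p) a)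
     = int (multiplicity (int p) d) - int (multiplicity (int p) c)"
    using ad by simp
  then show ?thesis
    using a b cd by (simp add: rat_padic_norm_def)
qed

lemma rat_as_frac:
  fixes q :: rat
  obtains a b :: int where "q = of_int a / of_int b" "b \<noteq> 0"
proof -
  obtain c d where cd: "quotient_of q = (c, d)" by fastforce
  show ?thesis
    by (rule that[of c d]) (use quotient_of_div[OF cd] quotient_of_denom_pos[OF cd] in auto)
qed

lemma rat_padic_norm_mult:
  assumes p: "prime p"
  shows "rat_padic_norm p (x * y) = rat_padic_norm p x * rat_padic_norm p y"
proof (cases "x = 0 \<or> y = 0")
  case False
  obtain a b :: int where x: "x = of_int a / of_int b" "b \<noteq> 0" by (rule rat_as_frac)
  obtain c d :: int where y: "y = of_int c / of_int d" "d \<noteq> 0" by (rule rat_as_frac)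
  have nz: "a \<noteq> 0" "c \<noteq> 0" using False x y by auto
  have pp: "prime_elem (int p)" using p by simp
  have p0: "real p \<noteq> 0" using p by (auto dest: prime_gt_0_nat)
  have "x * y = of_int (a * c) / of_int (b * d)" using x y by simp
  then have "rat_padic_norm p (x * y)
    = real p powi (int (multiplicity (int p) (b * d)) - int (multiplicity (int p) (a * c)))"
    using rat_padic_norm_frac[OF p, of "a * c" "b * d"] nz x y by simp
  also have "\<dots> = real p powi ((int (multiplicity (int p) b) - int (multiplicity (int p) a))
       + (int (multiplicity (int p) d) - int (multiplicity (int p) c)))"
    using nz x y pp by (simp add: prime_elem_multiplicity_mult_distrib algebra_simps)
  also have "\<dots> = rat_padic_norm p x * rat_padic_norm p y"
    using rat_padic_norm_frac[OF p] nz x y p0 by (simp add: power_int_add)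
  finally show ?thesis .
qed auto

lemma rat_padic_norm_pos:
  assumes "prime p" "x \<noteq> 0" shows "rat_padic_norm p x > 0"
  using assms by (simp add: rat_padic_norm_def prime_gt_0_nat zero_less_power_int)

lemma rat_padic_norm_eq_0_iff [simp]:
  "prime p \<Longrightarrow> rat_padic_norm p x = 0 \<longleftrightarrow> x = 0"
  using rat_padic_norm_pos[of p x] by (cases "x = 0") auto

lemma rat_padic_norm_nonneg [simp]: "rat_padic_norm p x \<ge> 0"
  by (simp add: rat_padic_norm_def zero_le_power_int)

lemma rat_padic_norm_minus [simp]: "rat_padic_norm p (- x) = rat_padic_norm p x"
  by (simp add: rat_padic_norm_def rat_uminus_code Let_def case_prod_unfold multiplicity_uminus_right)

lemma rat_padic_norm_1 [simp]: "rat_padic_norm p 1 = 1"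
  by (simp add: rat_padic_norm_def)

lemma rat_padic_norm_ultrametric:
  assumes p: "prime p"
  shows "rat_padic_norm p (x + y) \<le> max (rat_padic_norm p x) (rat_padic_norm p y)"
proof (cases "x = 0 \<or> y = 0 \<or> x + y = 0")
  case True
  then show ?thesis by (auto simp: max_def)
next
  case False
  obtain a b :: int where x: "x = of_int a / of_int b" "b \<noteq> 0" by (rule rat_as_frac)
  obtain c d :: int where y: "y = of_int c / of_int d" "d \<noteq> 0" by (rule rat_as_frac)
  define e f g where "e = a * d" and "f = c * b" and "g = b * d"
  have xe: "x = of_int e / of_int g" and yf: "y = of_int f / of_int g"
    using x y by (simp_all add: e_def f_def g_def)
  have g: "g \<noteq> 0" using x y by (simp add: g_def)
  have xy: "x + y = of_int (e + f) / of_int g" by (simp add: xe yf add_divide_distrib)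
  have nz: "e \<noteq> 0" "f \<noteq> 0" "e + f \<noteq> 0" using False xe yf xy by auto
  have pp: "\<not> is_unit (int p)" using p by (metis not_prime_unit prime_nat_int_transfer)
  let ?k = "min (multiplicity (int p) e) (multiplicity (int p) f)"
  have "int p ^ ?k dvd e" "int p ^ ?k dvd f"
    by (simp_all add: multiplicity_dvd')
  then have "int p ^ ?k dvd e + f" by (rule dvd_add)
  then have k: "?k \<le> multiplicity (int p) (e + f)"
    using nz pp by (intro multiplicity_geI) auto
  have p1: "real p \<ge> 1" using prime_ge_1_nat[OF p] by linarith
  note F = rat_padic_norm_frac[OF p _ g]
  show ?thesis
  proof (cases "multiplicity (int p) e \<le> multiplicity (int p) f")
    case True
    then have "rat_padic_norm p (x + y) \<le> rat_padic_norm p x"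
      unfolding xy unfolding xe F[OF nz(1)] F[OF nz(3)]
      using k p1 by (intro power_int_increasing) auto
    then show ?thesis by simp
  next
    case False
    then have "rat_padic_norm p (x + y) \<le> rat_padic_norm p y"
      unfolding xy unfolding yf F[OF nz(2)] F[OF nz(3)]
      using k p1 by (intro power_int_increasing) auto
    then show ?thesis by simp
  qed
qed


section \<open>The field of \<open>p\<close>-adic numbers\<close>

text \<open>
  The field of \<open>p\<close>-adic numbers is the completion of the rationals with respect to the
  \<open>p\<close>-adic absolute value: Cauchy sequences modulo null sequences.
  The prime \<open>p\<close> enters as the cardinality of a type parameter, so that every
  \<open>p\<close> gets its own type, which can carry the algebraic and topological classes.
\<close>

context
  fixes p :: nat
begin

definition rat_padic_null :: "(nat \<Rightarrow> rat) \<Rightarrow> bool" where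
  "rat_padic_null X \<longleftrightarrow> (\<lambda>n. rat_padic_norm p (X n)) \<longlonglongrightarrow> 0"

definition rat_padic_Cauchy :: "(nat \<Rightarrow> rat) \<Rightarrow> bool" where
  "rat_padic_Cauchy X \<longleftrightarrow> (\<forall>e>0. \<exists>N. \<forall>m\<ge>N. \<forall>n\<ge>N. rat_padic_norm p (X m - X n) < e)"

end

context
  fixes p :: nat
  assumes p: "prime p"
begin

lemma rat_padic_norm_diff_le:
  "rat_padic_norm p (x - y) \<le> max (rat_padic_norm p x) (rat_padic_norm p y)"
  using rat_padic_norm_ultrametric[OF p, of x "- y"] by simp

lemma rat_padic_norm_triangle:
  "rat_padic_norm p (x + y) \<le> rat_padic_norm p x + rat_padic_norm p y"
  using rat_padic_norm_ultrametric[OF p, of x y]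
    rat_padic_norm_nonneg[of p x] rat_padic_norm_nonneg[of p y] by linarith

lemma rat_padic_norm_diff_triangle:
  "\<bar>rat_padic_norm p x - rat_padic_norm p y\<bar> \<le> rat_padic_norm p (x - y)"
  using rat_padic_norm_triangle[of "x - y" y] rat_padic_norm_triangle[of "y - x" x]
    rat_padic_norm_minus[of p "x - y"] by auto

lemma rat_padic_Cauchy_convergent:
  assumes "rat_padic_Cauchy p X"
  shows "convergent (\<lambda>n. rat_padic_norm p (X n))"
proof (rule Cauchy_convergent, rule metric_CauchyI)
  fix e :: real assume "e > 0"
  then obtain N where N: "\<And>m n. m \<ge> N \<Longrightarrow> n \<ge> N \<Longrightarrow> rat_padic_norm p (X m - X n) < e"
    using assms unfolding rat_padic_Cauchy_def by blast
  show "\<exists>M. \<forall>m\<ge>M. \<forall>n\<ge>M. dist (rat_padic_norm p (X m)) (rat_padic_norm p (X n)) < e"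
  proof (intro exI allI impI)
    fix m n assume "m \<ge> N" "n \<ge> N"
    from N[OF this] show "dist (rat_padic_norm p (X m)) (rat_padic_norm p (X n)) < e"
      unfolding dist_real_def by (rule le_less_trans[OF rat_padic_norm_diff_triangle])
  qed
qed

lemma rat_padic_Cauchy_bounded:
  assumes "rat_padic_Cauchy p X"
  obtains B where "B > 0" "\<And>n. rat_padic_norm p (X n) \<le> B"
proof -
  have "Bseq (\<lambda>n. rat_padic_norm p (X n))"
    by (intro convergent_imp_Bseq rat_padic_Cauchy_convergent assms)
  then show ?thesis using that unfolding Bseq_def by auto
qed

lemma rat_padic_null_le:
  assumes "rat_padic_null p Y" "eventually (\<lambda>n. rat_padic_norm p (X n) \<le> rat_padic_norm p (Y n)) sequentially"
  shows "rat_padic_null p X"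
  using assms unfolding rat_padic_null_def
  by (auto intro: tendsto_sandwich[of "\<lambda>_. 0"])

lemma rat_padic_null_add:
  assumes "rat_padic_null p X" "rat_padic_null p Y"
  shows "rat_padic_null p (\<lambda>n. X n + Y n)"
proof -
  have "(\<lambda>n. rat_padic_norm p (X n) + rat_padic_norm p (Y n)) \<longlonglongrightarrow> 0"
    using tendsto_add[OF assms[unfolded rat_padic_null_def]] by simp
  then show ?thesis unfolding rat_padic_null_def
    by (rule tendsto_sandwich[OF _ _ tendsto_const, rotated 2])
       (auto simp: rat_padic_norm_triangle)
qed

lemma rat_padic_null_minus: "rat_padic_null p X \<Longrightarrow> rat_padic_null p (\<lambda>n. - X n)"
  by (simp add: rat_padic_null_def)

lemma rat_padic_null_mult:
  assumes X: "rat_padic_Cauchy p X" and Y: "rat_padic_null p Y"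
  shows "rat_padic_null p (\<lambda>n. X n * Y n)"
proof -
  obtain B where B: "B > 0" "\<And>n. rat_padic_norm p (X n) \<le> B"
    using rat_padic_Cauchy_bounded[OF X] by blast
  have "(\<lambda>n. B * rat_padic_norm p (Y n)) \<longlonglongrightarrow> 0"
    using tendsto_mult_right_zero[OF Y[unfolded rat_padic_null_def]] by simp
  then show ?thesis unfolding rat_padic_null_def
    by (rule tendsto_sandwich[OF _ _ tendsto_const, rotated 2])
       (auto simp: rat_padic_norm_mult[OF p] B intro!: always_eventually mult_right_mono)
qed

lemma rat_padic_Cauchy_const [simp]: "rat_padic_Cauchy p (\<lambda>_. c)"
  by (simp add: rat_padic_Cauchy_def)

lemma rat_padic_Cauchy_minus: "rat_padic_Cauchy p X \<Longrightarrow> rat_padic_Cauchy p (\<lambda>n. - X n)"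
  unfolding rat_padic_Cauchy_def
  by (metis (no_types, opaque_lifting) minus_diff_commute minus_diff_minus rat_padic_norm_minus)

lemma rat_padic_Cauchy_add:
  assumes "rat_padic_Cauchy p X" "rat_padic_Cauchy p Y"
  shows "rat_padic_Cauchy p (\<lambda>n. X n + Y n)"
  unfolding rat_padic_Cauchy_def
proof (intro allI impI)
  fix e :: real assume e: "e > 0"
  obtain N where N: "\<And>m n. m \<ge> N \<Longrightarrow> n \<ge> N \<Longrightarrow> rat_padic_norm p (X m - X n) < e"
    using assms(1) e unfolding rat_padic_Cauchy_def by blast
  obtain M where M: "\<And>m n. m \<ge> M \<Longrightarrow> n \<ge> M \<Longrightarrow> rat_padic_norm p (Y m - Y n) < e"
    using assms(2) e unfolding rat_padic_Cauchy_def by blast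
  have "rat_padic_norm p (X m + Y m - (X n + Y n)) < e" if "m \<ge> max N M" "n \<ge> max N M" for m n
    using N[of m n] M[of m n] that
      rat_padic_norm_ultrametric[OF p, of "X m - X n" "Y m - Y n"]
    by (simp add: algebra_simps)
  then show "\<exists>N. \<forall>m\<ge>N. \<forall>n\<ge>N. rat_padic_norm p (X m + Y m - (X n + Y n)) < e" by blast
qed

lemma rat_padic_Cauchy_mult:
  assumes X: "rat_padic_Cauchy p X" and Y: "rat_padic_Cauchy p Y"
  shows "rat_padic_Cauchy p (\<lambda>n. X n * Y n)"
  unfolding rat_padic_Cauchy_def
proof (intro allI impI)
  fix e :: real assume e: "e > 0"
  obtain B where B: "B > 0" "\<And>n. rat_padic_norm p (X n) \<le> B"
    using rat_padic_Cauchy_bounded[OF X] by blast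
  obtain C where C: "C > 0" "\<And>n. rat_padic_norm p (Y n) \<le> C"
    using rat_padic_Cauchy_bounded[OF Y] by blast
  obtain N where N: "\<And>m n. m \<ge> N \<Longrightarrow> n \<ge> N \<Longrightarrow> rat_padic_norm p (X m - X n) < e / C"
    using X e C unfolding rat_padic_Cauchy_def by (meson divide_pos_pos)
  obtain M where M: "\<And>m n. m \<ge> M \<Longrightarrow> n \<ge> M \<Longrightarrow> rat_padic_norm p (Y m - Y n) < e / B"
    using Y e B unfolding rat_padic_Cauchy_def by (meson divide_pos_pos)
  have "rat_padic_norm p (X m * Y m - X n * Y n) < e" if "m \<ge> max N M" "n \<ge> max N M" for m n
  proof -
    have "rat_padic_norm p (X m * (Y m - Y n)) \<le> B * rat_padic_norm p (Y m - Y n)"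
      unfolding rat_padic_norm_mult[OF p] by (intro mult_right_mono B) auto
    also have "\<dots> < e" using M[of m n] that B by (simp add: field_simps)
    finally have 1: "rat_padic_norm p (X m * (Y m - Y n)) < e" .
    have "rat_padic_norm p ((X m - X n) * Y n) \<le> rat_padic_norm p (X m - X n) * C"
      unfolding rat_padic_norm_mult[OF p] by (intro mult_left_mono C) auto
    also have "\<dots> < e" using N[of m n] that C by (simp add: field_simps)
    finally have 2: "rat_padic_norm p ((X m - X n) * Y n) < e" .
    have "X m * Y m - X n * Y n = X m * (Y m - Y n) + (X m - X n) * Y n"
      by (simp add: algebra_simps)
    then show ?thesis
      using rat_padic_norm_ultrametric[OF p, of "X m * (Y m - Y n)" "(X m - X n) * Y n"] 1 2
      by simp
  qed
  then show "\<exists>N. \<forall>m\<ge>N. \<forall>n\<ge>N. rat_padic_norm p (X m * Y m - X n * Y n) < e" by blast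
qed

lemma rat_padic_Cauchy_not_null:
  assumes X: "rat_padic_Cauchy p X" and nn: "\<not> rat_padic_null p X"
  obtains r N where "r > 0" "\<And>n. n \<ge> N \<Longrightarrow> rat_padic_norm p (X n) > r"
proof -
  obtain l where l: "(\<lambda>n. rat_padic_norm p (X n)) \<longlonglongrightarrow> l"
    using rat_padic_Cauchy_convergent[OF X] by (auto simp: convergent_def)
  have "l \<ge> 0" using l by (rule LIMSEQ_le_const) auto
  moreover have "l \<noteq> 0" using l nn by (auto simp: rat_padic_null_def)
  ultimately have "l / 2 < l" "l / 2 > 0" by auto
  from order_tendstoD(1)[OF l this(1)] this(2) show ?thesis
    using that unfolding eventually_sequentially by blast
qed

lemma rat_padic_Cauchy_inverse:
  assumes X: "rat_padic_Cauchy p X" and nn: "\<not> rat_padic_null p X"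
  shows "rat_padic_Cauchy p (\<lambda>n. inverse (X n))"
  unfolding rat_padic_Cauchy_def
proof (intro allI impI)
  fix e :: real assume e: "e > 0"
  obtain r N where r: "r > 0" "\<And>n. n \<ge> N \<Longrightarrow> rat_padic_norm p (X n) > r"
    using rat_padic_Cauchy_not_null[OF X nn] by blast
  have "e * (r * r) > 0" using e r by simp
  then obtain M where M: "\<And>m n. m \<ge> M \<Longrightarrow> n \<ge> M \<Longrightarrow> rat_padic_norm p (X m - X n) < e * (r * r)"
    using X unfolding rat_padic_Cauchy_def by blast
  have "rat_padic_norm p (inverse (X m) - inverse (X n)) < e"
    if mn: "m \<ge> max N M" "n \<ge> max N M" for m n
  proof (rule ccontr)
    assume "\<not> ?thesis"
    then have ge: "e \<le> rat_padic_norm p (inverse (X m) - inverse (X n))" by simp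
    have rm: "rat_padic_norm p (X m) > r" and rn: "rat_padic_norm p (X n) > r"
      using r mn by auto
    then have nz: "X m \<noteq> 0" "X n \<noteq> 0" using r by auto
    have "X n - X m = (inverse (X m) - inverse (X n)) * (X m * X n)"
      using nz by (simp add: field_simps)
    then have "rat_padic_norm p (X n - X m) =
      rat_padic_norm p (inverse (X m) - inverse (X n)) * (rat_padic_norm p (X m) * rat_padic_norm p (X n))"
      by (simp only: rat_padic_norm_mult[OF p])
    also have "\<dots> \<ge> e * (r * r)"
      using ge rm rn r e by (intro mult_mono) auto
    finally show False using M[of n m] mn by simp
  qed
  then show "\<exists>N. \<forall>m\<ge>N. \<forall>n\<ge>N. rat_padic_norm p (inverse (X m) - inverse (X n)) < e" by blast
qed

lemma rat_padic_null_diff: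
  assumes XY: "rat_padic_null p (\<lambda>n. X n - Y n)"
  shows "rat_padic_null p X \<longleftrightarrow> rat_padic_null p Y"
  using rat_padic_null_add[OF XY, of Y] rat_padic_null_add[OF rat_padic_null_minus[OF XY], of X]
  by auto

lemma rat_padic_null_diff_inverse:
  assumes X: "rat_padic_Cauchy p X" and Y: "rat_padic_Cauchy p Y"
    and N: "rat_padic_null p (\<lambda>n. X n - Y n)" and nn: "\<not> rat_padic_null p X"
  shows "rat_padic_null p (\<lambda>n. inverse (X n) - inverse (Y n))"
proof -
  have nnY: "\<not> rat_padic_null p Y" using rat_padic_null_diff[OF N] nn by simp
  note iX = rat_padic_Cauchy_inverse[OF X nn] and iY = rat_padic_Cauchy_inverse[OF Y nnY]
  obtain r N1 where r: "r > 0" "\<And>n. n \<ge> N1 \<Longrightarrow> rat_padic_norm p (X n) > r"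
    using rat_padic_Cauchy_not_null[OF X nn] by blast
  obtain s N2 where s: "s > 0" "\<And>n. n \<ge> N2 \<Longrightarrow> rat_padic_norm p (Y n) > s"
    using rat_padic_Cauchy_not_null[OF Y nnY] by blast
  show ?thesis
  proof (rule rat_padic_null_le)
    show "rat_padic_null p (\<lambda>n. (- inverse (X n) * inverse (Y n)) * (X n - Y n))"
      by (intro rat_padic_null_mult rat_padic_Cauchy_mult rat_padic_Cauchy_minus iX iY N)
    have "inverse (X n) - inverse (Y n) = (- inverse (X n) * inverse (Y n)) * (X n - Y n)"
      if "n \<ge> max N1 N2" for n
    proof -
      have "X n \<noteq> 0" "Y n \<noteq> 0" using r(1) r(2)[of n] s(1) s(2)[of n] that by auto
      then show ?thesis by (simp add: field_simps)
    qed
    then show "\<forall>\<^sub>F n in sequentially. rat_padic_norm p (inverse (X n) - inverse (Y n))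
      \<le> rat_padic_norm p ((- inverse (X n) * inverse (Y n)) * (X n - Y n))"
      unfolding eventually_sequentially by (metis order_refl)
  qed
qed

end

typedef (overloaded) 'a padic_Cauchy_seq = "{X. rat_padic_Cauchy CARD('a::prime_card) X}"
  by (rule exI[of _ "\<lambda>_. 0"]) (simp add: prime_card)

setup_lifting type_definition_padic_Cauchy_seq

instantiation padic_Cauchy_seq :: (prime_card) comm_ring_1
begin

lift_definition zero_padic_Cauchy_seq :: "'a padic_Cauchy_seq" is "\<lambda>_. 0"
  by (simp add: prime_card)

lift_definition one_padic_Cauchy_seq :: "'a padic_Cauchy_seq" is "\<lambda>_. 1"
  by (simp add: prime_card)

lift_definition uminus_padic_Cauchy_seq :: "'a padic_Cauchy_seq \<Rightarrow> 'a padic_Cauchy_seq"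
  is "\<lambda>X n. - X n"
  by (rule rat_padic_Cauchy_minus[OF prime_card])

lift_definition plus_padic_Cauchy_seq ::
  "'a padic_Cauchy_seq \<Rightarrow> 'a padic_Cauchy_seq \<Rightarrow> 'a padic_Cauchy_seq"
  is "\<lambda>X Y n. X n + Y n"
  by (rule rat_padic_Cauchy_add[OF prime_card])

lift_definition minus_padic_Cauchy_seq ::
  "'a padic_Cauchy_seq \<Rightarrow> 'a padic_Cauchy_seq \<Rightarrow> 'a padic_Cauchy_seq"
  is "\<lambda>X Y n. X n - Y n"
  using rat_padic_Cauchy_add[OF prime_card] rat_padic_Cauchy_minus[OF prime_card]
  by fastforce

lift_definition times_padic_Cauchy_seq ::
  "'a padic_Cauchy_seq \<Rightarrow> 'a padic_Cauchy_seq \<Rightarrow> 'a padic_Cauchy_seq"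
  is "\<lambda>X Y n. X n * Y n"
  by (rule rat_padic_Cauchy_mult[OF prime_card])

instance
proof
  show "(0::'a padic_Cauchy_seq) \<noteq> 1"
    by transfer (metis zero_neq_one)
qed (transfer; simp add: algebra_simps fun_eq_iff)+

end

lift_definition padic_null_seq :: "'a::prime_card padic_Cauchy_seq \<Rightarrow> bool"
  is "\<lambda>X. rat_padic_null CARD('a) X" .

lemma padic_null_seq_0 [simp]: "padic_null_seq 0"
  by transfer (simp add: rat_padic_null_def)

lemma padic_null_seq_add: "padic_null_seq X \<Longrightarrow> padic_null_seq Y \<Longrightarrow> padic_null_seq (X + Y)"
  by transfer (rule rat_padic_null_add[OF prime_card])

lemma padic_null_seq_minus: "padic_null_seq X \<Longrightarrow> padic_null_seq (- X)"
  by transfer (rule rat_padic_null_minus[OF prime_card])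

lemma padic_null_seq_mult: "padic_null_seq Y \<Longrightarrow> padic_null_seq (X * Y)"
  by transfer (rule rat_padic_null_mult[OF prime_card])

lift_definition padic_inverse_seq :: "'a::prime_card padic_Cauchy_seq \<Rightarrow> 'a padic_Cauchy_seq"
  is "\<lambda>X. if rat_padic_null CARD('a) X then (\<lambda>_. 0) else (\<lambda>n. inverse (X n))"
  using rat_padic_Cauchy_inverse[OF prime_card] by (auto simp: prime_card)

lemma padic_inverse_seq_null: "padic_null_seq X \<Longrightarrow> padic_inverse_seq X = 0"
  by transfer simp

lemma padic_inverse_seq:
  fixes X :: "'a::prime_card padic_Cauchy_seq"
  assumes "\<not> padic_null_seq X"
  shows "padic_null_seq (padic_inverse_seq X * X - 1)"
  using assms
proof transfer
  fix X assume X: "rat_padic_Cauchy CARD('a) X" and nn: "\<not> rat_padic_null CARD('a) X"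
  obtain r N where r: "r > 0" "\<And>n. n \<ge> N \<Longrightarrow> rat_padic_norm CARD('a) (X n) > r"
    using rat_padic_Cauchy_not_null[OF prime_card X nn] by blast
  have "eventually (\<lambda>n. rat_padic_norm CARD('a) (inverse (X n) * X n - 1) = 0) sequentially"
    unfolding eventually_sequentially
  proof (intro exI allI impI)
    fix n assume "n \<ge> N"
    then have "X n \<noteq> 0" using r(1) r(2)[of n] by auto
    then show "rat_padic_norm CARD('a) (inverse (X n) * X n - 1) = 0" by simp
  qed
  then show "rat_padic_null CARD('a)
      (\<lambda>n. (if rat_padic_null CARD('a) X then \<lambda>_. 0 else (\<lambda>n. inverse (X n))) n * X n - 1)"
    using nn by (simp add: rat_padic_null_def tendsto_eventually)
qed

lemma padic_null_seq_diff: "padic_null_seq (X - Y) \<Longrightarrow> padic_null_seq X \<longleftrightarrow> padic_null_seq Y"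
  by transfer (rule rat_padic_null_diff[OF prime_card])

lemma padic_null_seq_diff_inverse:
  fixes X Y :: "'a::prime_card padic_Cauchy_seq"
  assumes "padic_null_seq (X - Y)"
  shows "padic_null_seq (padic_inverse_seq X - padic_inverse_seq Y)"
proof (cases "padic_null_seq X")
  case True
  then show ?thesis using padic_null_seq_diff[OF assms] by (simp add: padic_inverse_seq_null)
next
  case False
  then have "\<not> padic_null_seq Y" using padic_null_seq_diff[OF assms] by simp
  with False assms show ?thesis
    by transfer (simp add: rat_padic_null_diff_inverse[OF prime_card])
qed

lift_definition padic_seq_norm :: "'a::prime_card padic_Cauchy_seq \<Rightarrow> real"
  is "\<lambda>X. lim (\<lambda>n. rat_padic_norm CARD('a) (X n))" .

lemma padic_seq_norm_tendsto:
  fixes X :: "'a::prime_card padic_Cauchy_seq"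
  shows "(\<lambda>n. rat_padic_norm CARD('a) (Rep_padic_Cauchy_seq X n)) \<longlonglongrightarrow> padic_seq_norm X"
  unfolding padic_seq_norm.rep_eq
  using rat_padic_Cauchy_convergent[OF prime_card] Rep_padic_Cauchy_seq[of X]
  by (simp add: convergent_LIMSEQ_iff)

lemma padic_seq_norm_eq_0_iff: "padic_seq_norm X = 0 \<longleftrightarrow> padic_null_seq X"
  unfolding padic_null_seq.rep_eq rat_padic_null_def
  using padic_seq_norm_tendsto[of X] LIMSEQ_unique by metis

lemma padic_seq_norm_nonneg: "padic_seq_norm X \<ge> 0"
  by (rule LIMSEQ_le_const[OF padic_seq_norm_tendsto]) auto

lemma padic_seq_norm_mult: "padic_seq_norm (X * Y) = padic_seq_norm X * padic_seq_norm Y"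
proof (rule LIMSEQ_unique[OF padic_seq_norm_tendsto])
  show "(\<lambda>n. rat_padic_norm CARD('a) (Rep_padic_Cauchy_seq (X * Y) n))
      \<longlonglongrightarrow> padic_seq_norm X * padic_seq_norm Y"
    unfolding times_padic_Cauchy_seq.rep_eq rat_padic_norm_mult[OF prime_card]
    by (intro tendsto_mult padic_seq_norm_tendsto)
qed

lemma padic_seq_norm_minus: "padic_seq_norm (- X) = padic_seq_norm X"
  by (simp add: padic_seq_norm.rep_eq uminus_padic_Cauchy_seq.rep_eq)

lemma padic_seq_norm_1: "padic_seq_norm 1 = 1"
  by (simp add: padic_seq_norm.rep_eq one_padic_Cauchy_seq.rep_eq)

lemma padic_seq_norm_ultrametric:
  "padic_seq_norm (X + Y) \<le> max (padic_seq_norm X) (padic_seq_norm Y)"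
proof (rule LIMSEQ_le[OF padic_seq_norm_tendsto])
  show "(\<lambda>n. max (rat_padic_norm CARD('a) (Rep_padic_Cauchy_seq X n))
                (rat_padic_norm CARD('a) (Rep_padic_Cauchy_seq Y n)))
      \<longlonglongrightarrow> max (padic_seq_norm X) (padic_seq_norm Y)"
    by (intro tendsto_max padic_seq_norm_tendsto)
qed (simp add: plus_padic_Cauchy_seq.rep_eq rat_padic_norm_ultrametric[OF prime_card])

lemma padic_seq_norm_cong:
  assumes "padic_null_seq (X - Y)"
  shows "padic_seq_norm X = padic_seq_norm Y"
proof -
  have 0: "padic_seq_norm (X - Y) = 0" using assms by (simp add: padic_seq_norm_eq_0_iff)
  then have "padic_seq_norm (Y - X) = 0" using padic_seq_norm_minus[of "X - Y"] by simp
  with 0 show ?thesis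
    using padic_seq_norm_ultrametric[of "X - Y" Y] padic_seq_norm_ultrametric[of "Y - X" X]
      padic_seq_norm_nonneg[of X] padic_seq_norm_nonneg[of Y] by (simp add: max_def split: if_splits)
qed

quotient_type (overloaded) 'a padic = "'a::prime_card padic_Cauchy_seq" /
  "\<lambda>X Y. padic_null_seq (X - Y)"
proof (rule equivpI)
  show "reflp (\<lambda>X Y. padic_null_seq (X - Y :: 'a padic_Cauchy_seq))" by (rule reflpI) simp
  show "symp (\<lambda>X Y. padic_null_seq (X - Y :: 'a padic_Cauchy_seq))"
    by (rule sympI) (metis minus_diff_eq padic_null_seq_minus)
  show "transp (\<lambda>X Y. padic_null_seq (X - Y :: 'a padic_Cauchy_seq))"
    by (rule transpI) (metis diff_add_cancel add_diff_eq padic_null_seq_add)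
qed

instantiation padic :: (prime_card) field
begin

lift_definition zero_padic :: "'a padic" is 0 .

lift_definition one_padic :: "'a padic" is 1 .

lift_definition uminus_padic :: "'a padic \<Rightarrow> 'a padic" is uminus
  by (metis minus_diff_minus padic_null_seq_minus)

lift_definition plus_padic :: "'a padic \<Rightarrow> 'a padic \<Rightarrow> 'a padic" is "(+)"
  by (metis add_diff_add padic_null_seq_add)

lift_definition minus_padic :: "'a padic \<Rightarrow> 'a padic \<Rightarrow> 'a padic" is "(-)"
proof -
  fix X X' Y Y' :: "'a padic_Cauchy_seq"
  assume "padic_null_seq (X - X')" "padic_null_seq (Y - Y')"
  from padic_null_seq_add[OF this(1) padic_null_seq_minus[OF this(2)]]
  show "padic_null_seq (X - Y - (X' - Y'))" by (simp add: algebra_simps)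
qed

lift_definition times_padic :: "'a padic \<Rightarrow> 'a padic \<Rightarrow> 'a padic" is "(*)"
proof -
  fix X X' Y Y' :: "'a padic_Cauchy_seq"
  assume "padic_null_seq (X - X')" "padic_null_seq (Y - Y')"
  from padic_null_seq_add[OF padic_null_seq_mult[OF this(1), of Y] padic_null_seq_mult[OF this(2), of X']]
  show "padic_null_seq (X * Y - X' * Y')" by (simp add: algebra_simps)
qed

lift_definition inverse_padic :: "'a padic \<Rightarrow> 'a padic" is padic_inverse_seq
  by (rule padic_null_seq_diff_inverse)

definition divide_padic :: "'a padic \<Rightarrow> 'a padic \<Rightarrow> 'a padic" where
  "divide_padic x y = x * inverse y"

instance
proof
  show "(0::'a padic) \<noteq> 1"
    by transfer (metis diff_0 padic_seq_norm_1 padic_seq_norm_eq_0_iff padic_seq_norm_minus zero_neq_one)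
  show "inverse x * x = 1" if "x \<noteq> 0" for x :: "'a padic"
    using that by transfer (simp add: padic_inverse_seq)
  show "x div y = x * inverse y" for x y :: "'a padic"
    by (rule divide_padic_def)
  show "inverse 0 = (0 :: 'a padic)"
    by transfer (simp add: padic_inverse_seq_null)
qed (transfer; simp add: algebra_simps)+

end

lift_definition padic_norm :: "'a::prime_card padic \<Rightarrow> real" is padic_seq_norm
  by (rule padic_seq_norm_cong)

lemma padic_norm_nonneg [simp]: "padic_norm x \<ge> 0"
  by transfer (rule padic_seq_norm_nonneg)

lemma padic_norm_eq_0_iff [simp]: "padic_norm x = 0 \<longleftrightarrow> x = 0"
  by transfer (simp add: padic_seq_norm_eq_0_iff)

lemma padic_norm_mult: "padic_norm (x * y) = padic_norm x * padic_norm y"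
  by transfer (rule padic_seq_norm_mult)

lemma padic_norm_minus [simp]: "padic_norm (- x) = padic_norm x"
  by transfer (rule padic_seq_norm_minus)

lemma padic_norm_1 [simp]: "padic_norm 1 = 1"
  by transfer (rule padic_seq_norm_1)

lemma padic_norm_ultrametric: "padic_norm (x + y) \<le> max (padic_norm x) (padic_norm y)"
  by transfer (rule padic_seq_norm_ultrametric)

instantiation padic :: (prime_card) metric_space
begin

definition dist_padic :: "'a padic \<Rightarrow> 'a padic \<Rightarrow> real" where
  "dist_padic x y = padic_norm (x - y)"

definition uniformity_padic :: "('a padic \<times> 'a padic) filter" where
  "uniformity_padic = (INF e\<in>{0 <..}. principal {(x, y). dist x y < e})"

definition open_padic :: "'a padic set \<Rightarrow> bool" where
  "open_padic U \<longleftrightarrow> (\<forall>x\<in>U. eventually (\<lambda>(x', y). x' = x \<longrightarrow> y \<in> U) uniformity)"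

instance
proof
  show "dist x y = 0 \<longleftrightarrow> x = y" for x y :: "'a padic"
    by (simp add: dist_padic_def)
  show "dist x y \<le> dist x z + dist y z" for x y z :: "'a padic"
    using padic_norm_ultrametric[of "x - z" "z - y", simplified] padic_norm_minus[of "y - z", unfolded minus_diff_eq]
      padic_norm_nonneg[of "x - z"] padic_norm_nonneg[of "y - z"]
    unfolding dist_padic_def by linarith
qed (rule uniformity_padic_def open_padic_def)+

end


section \<open>The additive character\<close>

definition is_padic_expansion :: "'p::prime_card padic \<Rightarrow> int \<Rightarrow> (nat \<Rightarrow> nat) \<Rightarrow> bool" where
  "is_padic_expansion x \<gamma> d \<longleftrightarrow> (\<forall>j. d j < CARD('p)) \<and> d 0 \<noteq> 0 \<and>
     (\<lambda>j. of_nat CARD('p) powi \<gamma> * (of_nat (d j) * of_nat CARD('p) ^ j)) sums x"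

text \<open>
  Outside the ring of integers the expansion exists, is unique, and has \<open>\<gamma> < 0\<close>,
  so the description below determines the fractional part.
\<close>

definition padic_frac :: "'p::prime_card padic \<Rightarrow> real" where
  "padic_frac x = (if padic_norm x \<le> 1 then 0 else
     (THE r. \<exists>\<gamma> d. is_padic_expansion x \<gamma> d \<and>
        r = real CARD('p) powi \<gamma> * (\<Sum>j<nat \<bar>\<gamma>\<bar>. real (d j) * real CARD('p) ^ j)))"

definition padic_char :: "'p::prime_card padic \<Rightarrow> complex" where
  "padic_char x = exp (2 * of_real pi * \<i> * of_real (padic_frac x))"


section \<open>Haar measure and the Fourier transform\<close>

text \<open>
  A translation-invariant Borel measure giving the ring of integers measure 1 is automatically
  finite on compact sets, and it is unique: it is the normalized Haar measure.
\<close>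

definition normalized_padic_haar :: "'p::prime_card padic measure \<Rightarrow> bool" where
  "normalized_padic_haar M \<longleftrightarrow> sets M = sets borel \<and>
     (\<forall>a. \<forall>A\<in>sets borel. emeasure M ((+) a ` A) = emeasure M A) \<and>
     emeasure M {x. padic_norm x \<le> 1} = 1"

definition padic_fourier ::
    "'p::prime_card padic measure \<Rightarrow> ('p padic \<Rightarrow> complex) \<Rightarrow> 'p padic \<Rightarrow> complex" where
  "padic_fourier M \<phi> \<xi> = (LINT x|M. padic_char (\<xi> * x) * \<phi> x)"


section \<open>Orthonormal bases of \<open>L\<^sup>2\<close>\<close>

text \<open>
  Elements of \<open>L\<^sup>2\<close> are represented by square-integrable functions;
  functions that agree almost everywhere have distance 0 with respect to \<open>L2_norm\<close>.
\<close>

definition square_integrable :: "'a measure \<Rightarrow> ('a \<Rightarrow> complex) \<Rightarrow> bool" where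
  "square_integrable M f \<longleftrightarrow>
     f \<in> borel_measurable M \<and> integrable M (\<lambda>x. (cmod (f x))\<^sup>2)"

definition L2_inner :: "'a measure \<Rightarrow> ('a \<Rightarrow> complex) \<Rightarrow> ('a \<Rightarrow> complex) \<Rightarrow> complex" where
  "L2_inner M f g = (LINT x|M. f x * cnj (g x))"

definition L2_norm :: "'a measure \<Rightarrow> ('a \<Rightarrow> complex) \<Rightarrow> real" where
  "L2_norm M f = sqrt (LINT x|M. (cmod (f x))\<^sup>2)"

definition L2_orthonormal_basis ::
    "'a measure \<Rightarrow> 'i set \<Rightarrow> ('i \<Rightarrow> 'a \<Rightarrow> complex) \<Rightarrow> bool" where
  "L2_orthonormal_basis M I e \<longleftrightarrow>
     (\<forall>i\<in>I. square_integrable M (e i)) \<and>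
     (\<forall>i\<in>I. \<forall>j\<in>I. L2_inner M (e i) (e j) = (if i = j then 1 else 0)) \<and>
     (\<forall>f. square_integrable M f \<longrightarrow> (\<forall>\<epsilon>>0. \<exists>F c. finite F \<and> F \<subseteq> I \<and>
        L2_norm M (\<lambda>x. f x - (\<Sum>i\<in>F. c i * e i x)) < \<epsilon>))"


section \<open>The wavelet functions\<close>

definition Omega :: "real \<Rightarrow> real" where
  "Omega t = (if 0 \<le> t \<and> t \<le> 1 then 1 else 0)"

definition padic_I :: "'p::prime_card padic set" where
  "padic_I = {of_nat CARD('p) powi (- int k) * (\<Sum>j<k. of_nat (a j) * of_nat CARD('p) ^ j) |k a.
     k \<ge> 1 \<and> (\<forall>j<k. a j < CARD('p))}"

definition padic_J :: "nat \<Rightarrow> 'p::prime_card padic set" where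
  "padic_J m = {of_nat CARD('p) powi (- int m) * (\<Sum>j<m. of_nat (s j) * of_nat CARD('p) ^ j) |s.
     (\<forall>j<m. s j < CARD('p)) \<and> s 0 \<noteq> (0::nat)}"

definition padic_theta ::
    "int \<Rightarrow> 'p::prime_card padic \<Rightarrow> 'p padic \<Rightarrow> 'p padic \<Rightarrow> complex" where
  "padic_theta \<gamma> s a x = of_real (real CARD('p) powr (- real_of_int \<gamma> / 2)) *
     padic_char (s * (of_nat CARD('p) powi \<gamma> * x - a)) *
     of_real (Omega (padic_norm (of_nat CARD('p) powi \<gamma> * x - a)))"

end

theory Submission
  imports Defs
begin

text \<open>
  Translation invariance alone evaluates the integral of a character over a ball: it is the
  measure of the ball times the value at the centre if the character is constant on the ball, and
  \<open>0\<close> otherwise. This gives the Fourier transforms and the orthonormality. For fixed \<open>\<gamma>\<close> and \<open>s\<close>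
  the transforms are, up to scalars, the characters of \<open>\<int>\<^sub>p\<close> transported to the ball
  \<open>p\<^sup>\<gamma>(-s + \<int>\<^sub>p)\<close>, and as \<open>\<gamma>\<close> and \<open>s\<close> vary these balls partition \<open>\<rat>\<^sub>p - {0}\<close>. Finite Fourier inversion
  puts the indicator of every smaller ball into the span; a \<open>\<pi>\<close>-\<open>\<lambda>\<close> argument and dominated
  convergence then give all of \<open>L\<^sup>2\<close>.
\<close>

section \<open>Arithmetic of the \<open>p\<close>-adic absolute value\<close>

text \<open>Orthonormality and completeness are both read off on the transform side, because there
  distinct pairs \<open>(\<gamma>, s)\<close> have disjoint supports, whereas the functions \<theta>
  at different scales can overlap. These supports form a partition thanks to
  \<open>padic_J m\<close>: its elements represent the classes modulo Z_p in the sphere of radius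
  p^m, so for fixed \<gamma> the balls tile exactly the sphere of radius p^(m - \<gamma>), and each
  nonzero point lies on one such sphere. The point 0 lies on none and is a null set.

  The first obstacle is \<open>padic_frac\<close>, a definite description over digit expansions that
  is additive only modulo 1. It is replaced by a criterion free of digits: every x is congruent
  modulo Z_p to some j / p^k with 0 <= j < p^k, and the real number j / p^k is determined by x. For
  the character the numerator matters only modulo p^k, so additivity becomes a computation with
  common denominators. All of this rests on the density of the rationals and on the nonzero values
  of the norm being powers of p.\<close>

abbreviation (input) padic_p :: "'p::prime_card padic" where
  "padic_p \<equiv> of_nat CARD('p)"

lemma card_gt_1: "real CARD('p::prime_card) > 1"
  using prime_gt_1_nat[OF prime_card[where 'a='p]] by linarith

lemma card_powi_le_iff [simp]:
  "real CARD('p::prime_card) powi m \<le> real CARD('p) powi n \<longleftrightarrow> m \<le> n"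
  using power_int_increasing[of m n "real CARD('p)"]
    power_int_strict_increasing[of n m "real CARD('p)"] card_gt_1[where 'p='p]
  by (cases "m \<le> n") auto

lemma card_powi_less_iff [simp]:
  "real CARD('p::prime_card) powi m < real CARD('p) powi n \<longleftrightarrow> m < n"
  using card_powi_le_iff[of n m, where 'p='p] by linarith

lemma card_powi_pos [simp]: "real CARD('p::prime_card) powi n > 0"
  using card_gt_1[where 'p='p] by (intro zero_less_power_int) linarith

lemma padic_norm_0 [simp]: "padic_norm 0 = 0"
  by simp

lemma padic_norm_pos: "x \<noteq> 0 \<Longrightarrow> padic_norm x > 0"
  using padic_norm_nonneg[of x] padic_norm_eq_0_iff[of x] by linarith

lemma padic_norm_minus_commute: "padic_norm (x - y) = padic_norm (y - x)"
  using padic_norm_minus[of "x - y"] by simp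

lemma padic_norm_diff_ultrametric: "padic_norm (x - y) \<le> max (padic_norm x) (padic_norm y)"
  using padic_norm_ultrametric[of x "- y"] by simp

lemma padic_norm_add_le: "padic_norm x \<le> r \<Longrightarrow> padic_norm y \<le> r \<Longrightarrow> padic_norm (x + y) \<le> r"
  using padic_norm_ultrametric[of x y] by linarith

lemma padic_norm_diff_le: "padic_norm x \<le> r \<Longrightarrow> padic_norm y \<le> r \<Longrightarrow> padic_norm (x - y) \<le> r"
  using padic_norm_diff_ultrametric[of x y] by linarith

text \<open>Ultrametric triangles are isosceles. This is how a norm is transferred between an
  element and its approximation.\<close>

lemma padic_norm_near:
  assumes "padic_norm (x - y) < padic_norm x"
  shows "padic_norm y = padic_norm x"
  using assms padic_norm_ultrametric[of "x - y" y] padic_norm_diff_ultrametric[of x "x - y"]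
  by simp

lemma padic_norm_inverse: "padic_norm (inverse x) = inverse (padic_norm x)"
proof (cases "x = 0")
  case False
  then have "padic_norm (inverse x) * padic_norm x = 1"
    by (simp flip: padic_norm_mult)
  then show ?thesis by (metis inverse_unique mult.commute)
qed simp

lemma padic_norm_divide: "padic_norm (x / y) = padic_norm x / padic_norm y"
  by (simp add: divide_inverse padic_norm_mult padic_norm_inverse)

lemma padic_norm_power: "padic_norm (x ^ n) = padic_norm x ^ n"
  by (induction n) (simp_all add: padic_norm_mult)

lemma padic_norm_power_int: "padic_norm (x powi n) = padic_norm x powi n"
  by (simp add: power_int_def padic_norm_power padic_norm_inverse)

section \<open>Embedding of the rationals as constant sequences\<close>

lift_definition padic_const_seq :: "rat \<Rightarrow> 'p::prime_card padic_Cauchy_seq" is "\<lambda>q _. q"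
  by (simp add: prime_card)

lemma padic_const_seq_0: "padic_const_seq 0 = 0"
  by transfer simp

lemma padic_const_seq_1: "padic_const_seq 1 = 1"
  by transfer simp

lemma padic_const_seq_minus: "padic_const_seq (- x) = - padic_const_seq x"
  by transfer simp

lemma padic_const_seq_add: "padic_const_seq (x + y) = padic_const_seq x + padic_const_seq y"
  by transfer simp

lemma padic_const_seq_mult: "padic_const_seq (x * y) = padic_const_seq x * padic_const_seq y"
  by transfer simp

lemma of_nat_padic: "(of_nat n :: 'p::prime_card padic) = abs_padic (padic_const_seq (of_nat n))"
proof (induction n)
  case 0
  show ?case by (simp add: padic_const_seq_0 zero_padic.abs_eq)
next
  case (Suc n)
  then show ?case
    by (simp add: padic_const_seq_add padic_const_seq_1 plus_padic.abs_eq one_padic.abs_eq)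
qed

lemma padic_norm_const_seq:
  "padic_norm (abs_padic (padic_const_seq q) :: 'p::prime_card padic) = rat_padic_norm CARD('p) q"
  by (simp add: padic_norm.abs_eq padic_seq_norm.rep_eq padic_const_seq.rep_eq)

text \<open>\<open>of_rat\<close> needs characteristic 0. The norm of a constant sequence is the
  rational norm of the constant, which is positive for a positive natural number.\<close>

instance padic :: (prime_card) field_char_0
proof
  have "padic_norm (of_nat n :: 'a padic) \<noteq> 0" if "n > 0" for n
    using that by (simp add: of_nat_padic padic_norm_const_seq prime_card del: padic_norm_eq_0_iff)
  then have nz: "(of_nat n :: 'a padic) \<noteq> 0" if "n > 0" for n
    using that by fastforce
  show "inj (of_nat :: nat \<Rightarrow> 'a padic)"
  proof (rule injI)
    fix m n assume eq: "(of_nat m :: 'a padic) = of_nat n"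
    show "m = n"
    proof (rule ccontr)
      assume "m \<noteq> n"
      then have "of_nat (m - n) \<noteq> (0 :: 'a padic) \<or> of_nat (n - m) \<noteq> (0 :: 'a padic)"
        using nz[of "m - n"] nz[of "n - m"] by linarith
      then show False using eq by (auto simp: of_nat_diff_if split: if_splits)
    qed
  qed
qed

lemma of_int_padic: "(of_int z :: 'p::prime_card padic) = abs_padic (padic_const_seq (of_int z))"
proof (cases z rule: int_cases2)
  case (nonneg n)
  then show ?thesis by (simp add: of_nat_padic)
next
  case (nonpos n)
  then show ?thesis by (simp add: of_nat_padic uminus_padic.abs_eq padic_const_seq_minus)
qed

lemma of_rat_padic: "(of_rat q :: 'p::prime_card padic) = abs_padic (padic_const_seq q)"
proof -
  obtain a b :: int where q: "q = of_int a / of_int b" "b \<noteq> 0" by (rule rat_as_frac)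
  have "abs_padic (padic_const_seq q) * (of_int b :: 'p padic) = of_int a"
    using q(2) by (simp add: q(1) of_int_padic times_padic.abs_eq flip: padic_const_seq_mult)
  then have "abs_padic (padic_const_seq q) = (of_int a / of_int b :: 'p padic)"
    using q(2) by (simp add: eq_divide_eq)
  then show ?thesis by (simp add: q(1) of_rat_divide)
qed

lemma padic_norm_of_rat: "padic_norm (of_rat q :: 'p::prime_card padic) = rat_padic_norm CARD('p) q"
  by (simp add: of_rat_padic padic_norm_const_seq)

lemma padic_norm_of_int:
  assumes "z \<noteq> 0"
  shows "padic_norm (of_int z :: 'p::prime_card padic)
    = real CARD('p) powi (- int (multiplicity (int CARD('p)) z))"
  using padic_norm_of_rat[of "of_int z", where 'p='p]
    rat_padic_norm_frac[OF prime_card[where 'a='p] assms, of 1] by simp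

lemma not_unit_card: "\<not> is_unit (int CARD('p::prime_card))"
  using card_gt_1[where 'p='p] by auto

text \<open>For nonzero \<open>z\<close> the multiplicity of p is minus the exponent of the norm.
  Congruence arguments about numerators pass through this equivalence.\<close>

lemma padic_norm_of_int_le_iff:
  "padic_norm (of_int z :: 'p::prime_card padic) \<le> real CARD('p) powi (- int k)
    \<longleftrightarrow> int CARD('p) ^ k dvd z"
proof (cases "z = 0")
  case False
  have "padic_norm (of_int z :: 'p::prime_card padic) \<le> real CARD('p) powi (- int k)
    \<longleftrightarrow> k \<le> multiplicity (int CARD('p)) z"
    unfolding padic_norm_of_int[OF False]
    by simp
  also have "\<dots> \<longleftrightarrow> int CARD('p) ^ k dvd z"
    using False not_unit_card[where 'p='p] by (simp add: power_dvd_iff_le_multiplicity)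
  finally show ?thesis .
qed (simp add: zero_le_power_int)

lemma padic_norm_of_int_le_1: "padic_norm (of_int z) \<le> 1"
  using padic_norm_of_int_le_iff[of z 0] by simp

lemma padic_norm_of_nat_le_1: "padic_norm (of_nat n) \<le> 1"
  using padic_norm_of_int_le_1[of "int n"] by simp

lemma padic_norm_p: "padic_norm (padic_p :: 'p::prime_card padic) = 1 / real CARD('p)"
proof -
  have "multiplicity (int CARD('p)) (int CARD('p)) = 1"
    using not_unit_card[where 'p='p] by (simp add: multiplicity_self)
  then show ?thesis
    using padic_norm_of_int[of "int CARD('p)", where 'p='p] by (simp add: power_int_minus divide_inverse)
qed

lemma padic_norm_p_powi:
  "padic_norm (padic_p powi n :: 'p::prime_card padic) = real CARD('p) powi (- n)"
  by (simp add: padic_norm_power_int padic_norm_p power_int_minus power_int_divide_distrib divide_inverse power_int_inverse)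

lemma padic_norm_p_power:
  "padic_norm (padic_p ^ n :: 'p::prime_card padic) = 1 / real CARD('p) ^ n"
  by (simp add: padic_norm_power padic_norm_p power_divide)

section \<open>Density of the rationals, discreteness of the norm, residues modulo p\<close>

lemma of_rat_dense:
  fixes x :: "'p::prime_card padic"
  assumes "e > 0"
  obtains q where "padic_norm (x - of_rat q) < e"
proof -
  obtain X where X: "x = abs_padic X" by (induction x rule: padic.abs_induct) blast
  have C: "rat_padic_Cauchy CARD('p) (Rep_padic_Cauchy_seq X)"
    using Rep_padic_Cauchy_seq[of X] by simp
  obtain N where N: "\<And>m n. m \<ge> N \<Longrightarrow> n \<ge> N \<Longrightarrow>
      rat_padic_norm CARD('p) (Rep_padic_Cauchy_seq X m - Rep_padic_Cauchy_seq X n) < e / 2"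
    using C assms unfolding rat_padic_Cauchy_def by (meson half_gt_zero)
  \<comment> \<open>A late term of a representing Cauchy sequence. The bound \<open>e / 2\<close>
    leaves room because the limit of the norms only inherits a weak inequality.\<close>
  define q where "q = Rep_padic_Cauchy_seq X N"
  have "padic_norm (x - of_rat q) = padic_seq_norm (X - padic_const_seq q)"
    by (simp add: X of_rat_padic minus_padic.abs_eq padic_norm.abs_eq)
  also have "\<dots> \<le> e / 2"
  proof (rule LIMSEQ_le_const2[OF padic_seq_norm_tendsto], intro exI allI impI)
    fix n assume "n \<ge> N"
    then show "rat_padic_norm CARD('p) (Rep_padic_Cauchy_seq (X - padic_const_seq q) n) \<le> e / 2"
      using N[of n N] by (simp add: minus_padic_Cauchy_seq.rep_eq padic_const_seq.rep_eq q_def)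
  qed
  also have "\<dots> < e" using assms by simp
  finally show ?thesis by (rule that)
qed

text \<open>A rational closer to \<open>x\<close> than the norm of \<open>x\<close> has the same
  norm by the isosceles property, and norms of nonzero rationals are powers of p.\<close>

lemma padic_norm_cases:
  fixes x :: "'p::prime_card padic"
  assumes "x \<noteq> 0"
  obtains n where "padic_norm x = real CARD('p) powi n"
proof -
  obtain q where q: "padic_norm (x - of_rat q) < padic_norm x"
    using of_rat_dense[OF padic_norm_pos[OF assms]] .
  then have *: "rat_padic_norm CARD('p) q = padic_norm x"
    using padic_norm_near[OF q] by (simp add: padic_norm_of_rat)
  with padic_norm_pos[OF assms] have "q \<noteq> 0" by auto
  with * show ?thesis
    using that unfolding rat_padic_norm_def by metis
qed

text \<open>The norm takes no value strictly between consecutive powers of p; this upgrades an error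
  < 1 to an error <= 1 / p when residues are constructed.\<close>

lemma padic_norm_less_powi:
  fixes x :: "'p::prime_card padic"
  assumes "padic_norm x < real CARD('p) powi n"
  shows "padic_norm x \<le> real CARD('p) powi (n - 1)"
proof (cases "x = 0")
  case False
  then obtain k where k: "padic_norm x = real CARD('p) powi k" by (rule padic_norm_cases)
  then have "k < n" using assms by simp
  then show ?thesis using k by simp
qed (simp add: zero_le_power_int)

text \<open>A rational a / b at distance less than 1 from \<open>x\<close> is itself integral, hence
  p does not divide b in lowest terms, and a / b is congruent modulo p to a times an inverse of
  b.\<close>

lemma residue_exists:
  fixes x :: "'p::prime_card padic"
  assumes "padic_norm x \<le> 1"
  obtains d where "d < CARD('p)" "padic_norm (x - of_nat d) \<le> 1 / real CARD('p)"
proof -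
  let ?p = "int CARD('p)"
  have p0: "real CARD('p) > 1" by (rule card_gt_1)
  obtain q where q: "padic_norm (x - of_rat q) < 1" using of_rat_dense[of 1 x] by auto
  obtain a b where ab: "quotient_of q = (a, b)" by fastforce
  have qab: "q = of_int a / of_int b" and b: "b > 0" and cop: "coprime a b"
    using quotient_of_div[OF ab] quotient_of_denom_pos[OF ab] quotient_of_coprime[OF ab] by auto
  have nq: "padic_norm (of_rat q :: 'p padic) \<le> 1"
    using padic_norm_diff_le[OF assms, of "x - of_rat q"] q by simp
  have nb: "\<not> ?p dvd b"
  proof
    assume pb: "?p dvd b"
    then have "\<not> ?p dvd a" using cop not_unit_card[where 'p='p] coprime_common_divisor by blast
    then have "multiplicity ?p a = 0" by (rule not_dvd_imp_multiplicity_0)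
    moreover from this have "a \<noteq> 0" using \<open>\<not> ?p dvd a\<close> by auto
    ultimately have "padic_norm (of_int a :: 'p padic) = 1" by (simp add: padic_norm_of_int)
    moreover have "padic_norm (of_int b :: 'p padic) \<le> 1 / real CARD('p)"
      using padic_norm_of_int_le_iff[of b 1, where 'p='p] pb
      by (simp add: power_int_minus divide_inverse)
    then have "padic_norm (of_int b :: 'p padic) < 1" using p0 by (smt (verit) divide_less_eq_1)
    moreover have "padic_norm (of_int b :: 'p padic) > 0" using b by (intro padic_norm_pos) auto
    ultimately have "padic_norm (of_rat q :: 'p padic) > 1"
      by (simp add: qab of_rat_divide padic_norm_divide)
    with nq show False by simp
  qed
  have pr: "prime ?p" using prime_card[where 'a='p] by simp
  have "coprime b ?p" using prime_imp_coprime[OF pr nb] by (simp add: coprime_commute)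
  then obtain c where c: "[b * c = 1] (mod ?p)" using cong_solve_coprime_int by blast
  define d where "d = nat (a * c mod ?p)"
  have pp: "?p > 0" using p0 by linarith
  have dd: "int d = a * c mod ?p" using pp by (simp add: d_def)
  have "[b * (a * c mod ?p) = a * (b * c)] (mod ?p)"
    by (simp add: cong_def mod_mult_right_eq ac_simps)
  also have "[a * (b * c) = a * 1] (mod ?p)" by (intro cong_mult cong_refl c)
  finally have "?p dvd a - b * int d" unfolding dd by (simp add: cong_iff_dvd_diff dvd_diff_commute)
  then have 1: "padic_norm (of_int (a - b * int d) :: 'p padic) \<le> 1 / real CARD('p)"
    using padic_norm_of_int_le_iff[of "a - b * int d" 1, where 'p='p]
    by (simp add: power_int_minus divide_inverse)
  have "multiplicity ?p b = 0" using nb by (rule not_dvd_imp_multiplicity_0)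
  then have nb1: "padic_norm (of_int b :: 'p padic) = 1" using b by (simp add: padic_norm_of_int)
  have "of_rat q - of_nat d = (of_int (a - b * int d) :: 'p padic) / of_int b"
    using b by (simp add: qab of_rat_divide field_simps)
  then have 2: "padic_norm (of_rat q - of_nat d :: 'p padic) \<le> 1 / real CARD('p)"
    using 1 nb1 by (simp add: padic_norm_divide)
  have 3: "padic_norm (x - of_rat q) \<le> 1 / real CARD('p)"
    using padic_norm_less_powi[of "x - of_rat q" 0] q by (simp add: power_int_minus divide_inverse)
  have "padic_norm (x - of_nat d) \<le> 1 / real CARD('p)"
    using padic_norm_add_le[OF 3 2] by simp
  moreover have "d < CARD('p)" using dd pp by (metis of_nat_less_iff pos_mod_bound)
  ultimately show ?thesis using that by blast
qed

section \<open>Digit expansions and the additive character\<close>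

lemma padic_p_nonzero: "(padic_p :: 'p::prime_card padic) \<noteq> 0"
  using padic_norm_p[where 'p='p] by force

lemma padic_norm_div_p_power:
  "padic_norm (x / padic_p ^ k :: 'p::prime_card padic) = padic_norm x * real CARD('p) ^ k"
  by (simp add: padic_norm_divide padic_norm_p_power)

text \<open>Successive approximation: the error after k digits, divided by p^k, is integral again,
  and its residue is the digit at p^k.\<close>

lemma residue_power_exists:
  fixes x :: "'p::prime_card padic"
  assumes x: "padic_norm x \<le> 1"
  shows "\<exists>j<CARD('p) ^ k. padic_norm (x - of_nat j) \<le> 1 / real CARD('p) ^ k"
proof (induction k)
  case (Suc k)
  then obtain j where j: "j < CARD('p) ^ k" "padic_norm (x - of_nat j) \<le> 1 / real CARD('p) ^ k"
    by blast
  have p0: "real CARD('p) > 0" using card_gt_1[where 'p='p] by linarith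
  have "padic_norm ((x - of_nat j) / padic_p ^ k) \<le> 1"
    using j(2) p0 by (simp add: padic_norm_div_p_power field_simps)
  then obtain d where d: "d < CARD('p)"
      "padic_norm ((x - of_nat j) / padic_p ^ k - of_nat d) \<le> 1 / real CARD('p)"
    by (rule residue_exists)
  define r where "r = (x - of_nat j) / padic_p ^ k - of_nat d"
  have "x - of_nat (j + d * CARD('p) ^ k) = padic_p ^ k * r"
    using padic_p_nonzero[where 'p='p] by (simp add: r_def field_simps)
  then have "padic_norm (x - of_nat (j + d * CARD('p) ^ k)) \<le> 1 / real CARD('p) ^ Suc k"
    using d(2)[folded r_def] p0 by (simp add: padic_norm_mult padic_norm_p_power field_simps)
  moreover have "j + d * CARD('p) ^ k < CARD('p) ^ Suc k"
  proof -
    have "j + d * CARD('p) ^ k < Suc d * CARD('p) ^ k" using j(1) by simp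
    also have "\<dots> \<le> CARD('p) * CARD('p) ^ k" using d(1) by (intro mult_right_mono) auto
    finally show ?thesis by simp
  qed
  ultimately show ?case by blast
qed (use x in auto)

lemma fraction_exists:
  fixes x :: "'p::prime_card padic"
  obtains j k where "j < CARD('p) ^ k" "padic_norm (x - of_nat j / padic_p ^ k) \<le> 1"
proof (cases "x = 0")
  case True
  then show ?thesis using that[of 0 0] by simp
next
  case False
  have p0: "real CARD('p) > 0" using card_gt_1[where 'p='p] by linarith
  obtain n where n: "padic_norm x = real CARD('p) powi n" using False by (rule padic_norm_cases)
  \<comment> \<open>Multiplication by p^n makes \<open>x\<close> integral. For n < 0 truncation
    gives k = 0, and then j < 1 leaves the fraction 0.\<close>
  define k where "k = nat n"
  have "padic_norm (x * padic_p ^ k) = real CARD('p) powi (n - int k)"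
    using p0 by (simp add: padic_norm_mult n padic_norm_p_power power_int_diff)
  also have "\<dots> \<le> real CARD('p) powi 0"
    unfolding card_powi_le_iff by (simp add: k_def)
  finally obtain j where j: "j < CARD('p) ^ k"
      "padic_norm (x * padic_p ^ k - of_nat j) \<le> 1 / real CARD('p) ^ k"
    using residue_power_exists[of "x * padic_p ^ k" k] by auto
  have "x - of_nat j / padic_p ^ k = (x * padic_p ^ k - of_nat j) / padic_p ^ k"
    using padic_p_nonzero[where 'p='p] by (simp add: field_simps)
  then have "padic_norm (x - of_nat j / padic_p ^ k) \<le> 1"
    using j(2) p0 by (simp add: padic_norm_div_p_power field_simps)
  with j(1) show ?thesis using that by blast
qed

lemma padic_norm_int_div_p_power_le_1_iff:
  "padic_norm (of_int z / padic_p ^ k :: 'p::prime_card padic) \<le> 1 \<longleftrightarrow> int CARD('p) ^ k dvd z"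
proof -
  have p0: "real CARD('p) > 0" using card_gt_1[where 'p='p] by linarith
  show ?thesis
    unfolding padic_norm_of_int_le_iff[symmetric] padic_norm_div_p_power
    using p0 by (simp add: power_int_minus field_simps)
qed

text \<open>Both fractions lie in [0, 1), so over the common denominator p^(k + k') the numerators
  differ by less than that denominator, which also divides their difference by integrality. The
  conclusion is in the reals, where \<open>padic_frac\<close> takes its values.\<close>

lemma fraction_unique:
  assumes j: "j < CARD('p::prime_card) ^ k" "j' < CARD('p) ^ k'"
    and le: "padic_norm (of_nat j / padic_p ^ k - of_nat j' / padic_p ^ k' :: 'p padic) \<le> 1"
  shows "real j / real CARD('p) ^ k = real j' / real CARD('p) ^ k'"
proof -
  define z where "z = int j * int CARD('p) ^ k' - int j' * int CARD('p) ^ k"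
  have pz: "CARD('p) > 0" using card_gt_1[where 'p='p] by linarith
  have "of_nat j / padic_p ^ k - of_nat j' / padic_p ^ k'
      = (of_int z / padic_p ^ (k + k') :: 'p padic)"
    using padic_p_nonzero[where 'p='p] by (simp add: z_def field_simps power_add)
  with le have dvd: "int CARD('p) ^ (k + k') dvd z"
    by (simp only: padic_norm_int_div_p_power_le_1_iff)
  have "int j * int CARD('p) ^ k' < int CARD('p) ^ k * int CARD('p) ^ k'"
    using j(1) pz by (intro mult_strict_right_mono) (simp_all flip: of_nat_power)
  moreover have "int j' * int CARD('p) ^ k < int CARD('p) ^ k' * int CARD('p) ^ k"
    using j(2) pz by (intro mult_strict_right_mono) (simp_all flip: of_nat_power)
  ultimately have "\<bar>z\<bar> < int CARD('p) ^ (k + k')"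
    unfolding z_def power_add
    by (smt (verit, best) mult.commute of_nat_0_le_iff zero_le_mult_iff zero_le_power)
  with dvd have "z = 0" using zdvd_not_zless[of "\<bar>z\<bar>"] by force
  then have "int (j * CARD('p) ^ k') = int (j' * CARD('p) ^ k)" by (simp add: z_def)
  then have "j * CARD('p) ^ k' = j' * CARD('p) ^ k" by (simp only: of_nat_eq_iff)
  then have "real j * real CARD('p) ^ k' = real j' * real CARD('p) ^ k"
    by (simp flip: of_nat_mult of_nat_power)
  then show ?thesis using pz by (simp add: field_simps)
qed

lemma digit_sum_less:
  fixes d :: "nat \<Rightarrow> nat"
  assumes "\<And>j. j < k \<Longrightarrow> d j < p"
  shows "(\<Sum>j<k. d j * p ^ j) < p ^ k"
  using assms
proof (induction k)
  case (Suc k)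
  then have "(\<Sum>j<Suc k. d j * p ^ j) < Suc (d k) * p ^ k" by simp
  also have "\<dots> \<le> p * p ^ k" using Suc.prems[of k] by (intro mult_right_mono) auto
  finally show ?case by simp
qed simp

lemma digits_exist:
  fixes n p :: nat
  assumes "n < p ^ k" and p: "p > 0"
  shows "\<exists>d. (\<forall>j. d j < p) \<and> n = (\<Sum>j<k. d j * p ^ j)"
  using assms(1)
proof (induction k arbitrary: n)
  case 0
  then show ?case using p by (intro exI[of _ "\<lambda>_. 0"]) auto
next
  case (Suc k)
  have "n mod p ^ k < p ^ k" using p by simp
  then obtain d where d: "\<forall>j. d j < p" "n mod p ^ k = (\<Sum>j<k. d j * p ^ j)"
    using Suc.IH by blast
  have "n div p ^ k < p" using Suc.prems by (simp add: less_mult_imp_div_less)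
  moreover have "n = n div p ^ k * p ^ k + n mod p ^ k" by (rule div_mult_mod_eq[symmetric])
  ultimately show ?case using d
    by (intro exI[of _ "d(k := n div p ^ k)"]) simp
qed

section \<open>Digit expansions through the shift map\<close>

definition padic_residue :: "'p::prime_card padic \<Rightarrow> nat" where
  "padic_residue x = (SOME d. d < CARD('p) \<and> padic_norm (x - of_nat d) \<le> 1 / real CARD('p))"

text \<open>The one-sided shift on digit sequences: for an integral element, the residue of the j-th
  iterate is the j-th digit.\<close>

definition padic_shift :: "'p::prime_card padic \<Rightarrow> 'p padic" where
  "padic_shift x = (x - of_nat (padic_residue x)) / padic_p"

lemma padic_residue:
  fixes x :: "'p::prime_card padic"
  assumes "padic_norm x \<le> 1"
  shows "padic_residue x < CARD('p)" "padic_norm (x - of_nat (padic_residue x)) \<le> 1 / real CARD('p)"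
  using residue_exists[OF assms] someI_ex[of "\<lambda>d. d < CARD('p) \<and> padic_norm (x - of_nat d) \<le> 1 / real CARD('p)"]
  unfolding padic_residue_def by blast+

lemma padic_shift_le_1:
  fixes x :: "'p::prime_card padic"
  assumes "padic_norm x \<le> 1"
  shows "padic_norm (padic_shift x) \<le> 1"
  using padic_residue(2)[OF assms] card_gt_1[where 'p='p]
  by (simp add: padic_shift_def padic_norm_divide padic_norm_p field_simps)

text \<open>Each step unfolds z = residue + p * shift of z, an algebraic identity whatever residue
  is chosen, so the formula holds for every \<open>y\<close>.\<close>

lemma padic_digit_remainder:
  fixes y :: "'p::prime_card padic"
  shows "y = (\<Sum>j<n. of_nat (padic_residue ((padic_shift ^^ j) y)) * padic_p ^ j)
      + padic_p ^ n * (padic_shift ^^ n) y"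
proof (induction n)
  case (Suc n)
  have "(padic_shift ^^ n) y = of_nat (padic_residue ((padic_shift ^^ n) y))
      + padic_p * (padic_shift ^^ Suc n) y"
    using padic_p_nonzero[where 'p='p] by (simp add: padic_shift_def)
  from arg_cong[OF this, of "(*) (padic_p ^ n)"] have e: "padic_p ^ n * (padic_shift ^^ n) y
     = of_nat (padic_residue ((padic_shift ^^ n) y)) * padic_p ^ n + padic_p ^ Suc n * (padic_shift ^^ Suc n) y"
    by (simp add: algebra_simps del: funpow.simps)
  show ?case unfolding sum.lessThan_Suc add.assoc e[symmetric] by (rule Suc)
qed simp

text \<open>\<open>padic_frac\<close> is a definite description over expansions, so one has to
  exist. Rescaling to norm 1 forces the leading digit to be nonzero.\<close>

lemma padic_expansion_exists:
  fixes x :: "'p::prime_card padic"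
  assumes "x \<noteq> 0"
  shows "\<exists>\<gamma> d. is_padic_expansion x \<gamma> d"
proof -
  have p1: "real CARD('p) > 1" by (rule card_gt_1)
  obtain n where n: "padic_norm x = real CARD('p) powi n" using assms by (rule padic_norm_cases)
  define y where "y = x * padic_p powi n"
  define d where "d j = padic_residue ((padic_shift ^^ j) y)" for j
  have y1: "padic_norm y = 1"
    using p1 by (simp add: y_def padic_norm_mult padic_norm_p_powi n power_int_minus)
  have yn: "padic_norm ((padic_shift ^^ j) y) \<le> 1" for j
    by (induction j) (simp_all add: y1 padic_shift_le_1)
  have "d 0 \<noteq> 0"
  proof
    assume "d 0 = 0"
    then have "padic_norm y \<le> 1 / real CARD('p)"
      using padic_residue(2)[of y] y1 by (simp add: d_def)
    then show False using y1 p1 by simp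
  qed
  moreover have "(\<lambda>j. padic_p powi (- n) * (of_nat (d j) * padic_p ^ j)) sums x"
    \<comment> \<open>The remainder after N digits is p^(N - n) times an iterated shift of
      \<open>y\<close>, which is integral, so its norm is at most p^(n - N).\<close>
    unfolding sums_def tendsto_dist_iff[of _ x]
  proof (rule tendsto_sandwich[of "\<lambda>_. 0"])
    have xy: "x = padic_p powi (- n) * y"
      using padic_p_nonzero[where 'p='p] by (simp add: y_def power_int_minus)
    have "dist (\<Sum>j<N. padic_p powi (- n) * (of_nat (d j) * padic_p ^ j)) x
        \<le> real CARD('p) powi n * (1 / real CARD('p)) ^ N" for N
    proof -
      have "x - (\<Sum>j<N. padic_p powi (- n) * (of_nat (d j) * padic_p ^ j))
          = padic_p powi (- n) * (y - (\<Sum>j<N. of_nat (d j) * padic_p ^ j))"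
        by (simp add: right_diff_distrib sum_distrib_left xy)
      also have "y - (\<Sum>j<N. of_nat (d j) * padic_p ^ j) = padic_p ^ N * (padic_shift ^^ N) y"
        unfolding d_def diff_eq_eq by (subst add.commute) (rule padic_digit_remainder)
      finally have "padic_norm (x - (\<Sum>j<N. padic_p powi (- n) * (of_nat (d j) * padic_p ^ j)))
         = real CARD('p) powi n * ((1 / real CARD('p) ^ N) * padic_norm ((padic_shift ^^ N) y))"
        by (simp add: padic_norm_mult padic_norm_p_powi padic_norm_p_power)
      also have "\<dots> \<le> real CARD('p) powi n * ((1 / real CARD('p) ^ N) * 1)"
        using yn[of N] by (intro mult_left_mono) (auto simp: zero_le_power_int)
      finally show ?thesis
        by (simp add: dist_padic_def padic_norm_minus_commute power_divide)
    qed
    then show "\<forall>\<^sub>F N in sequentially. dist (\<Sum>j<N. padic_p powi (- n) * (of_nat (d j) * padic_p ^ j)) x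
        \<le> real CARD('p) powi n * (1 / real CARD('p)) ^ N" by simp
    show "(\<lambda>N. real CARD('p) powi n * (1 / real CARD('p)) ^ N) \<longlonglongrightarrow> 0"
      using p1 by (intro tendsto_mult_right_zero LIMSEQ_realpow_zero) auto
  qed auto
  moreover have "d j < CARD('p)" for j
    unfolding d_def by (rule padic_residue(1)[OF yn])
  ultimately show ?thesis unfolding is_padic_expansion_def by blast
qed

text \<open>The ultrametric inequality does not add up errors, so a single term within
  \<open>r\<close> of both the limit and \<open>c\<close> suffices.\<close>

lemma padic_norm_limit_le:
  fixes x :: "'p::prime_card padic"
  assumes "S \<longlonglongrightarrow> x" and "r > 0" and "\<And>n. n \<ge> N \<Longrightarrow> padic_norm (S n - c) \<le> r"
  shows "padic_norm (x - c) \<le> r"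
proof -
  obtain M where "\<And>n. n \<ge> M \<Longrightarrow> dist (S n) x < r"
    using assms(1,2) by (meson LIMSEQ_def)
  then have "padic_norm (x - S (max M N)) \<le> r"
    by (simp add: dist_padic_def padic_norm_minus_commute less_imp_le)
  from padic_norm_add_le[OF this assms(3)[of "max M N"]] show ?thesis by simp
qed

text \<open>All terms from index \<open>K\<close> on have norm at most p^(-\<gamma> - K), and such a
  bound survives finite sums and the limit.\<close>

lemma padic_expansion_tail:
  fixes x :: "'p::prime_card padic"
  assumes "is_padic_expansion x \<gamma> d"
  shows "padic_norm (x - padic_p powi \<gamma> * of_nat (\<Sum>j<K. d j * CARD('p) ^ j))
    \<le> real CARD('p) powi (- \<gamma> - int K)"
proof (rule padic_norm_limit_le[where N = K])
  have p1: "real CARD('p) > 1" by (rule card_gt_1)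
  show "(\<lambda>n. \<Sum>j<n. padic_p powi \<gamma> * (of_nat (d j) * padic_p ^ j)) \<longlonglongrightarrow> x"
    using assms by (simp add: is_padic_expansion_def sums_def)
  fix n assume "K \<le> n"
  then show "padic_norm ((\<Sum>j<n. padic_p powi \<gamma> * (of_nat (d j) * padic_p ^ j))
      - padic_p powi \<gamma> * of_nat (\<Sum>j<K. d j * CARD('p) ^ j) :: 'p padic)
      \<le> real CARD('p) powi (- \<gamma> - int K)"
  proof (induction n rule: dec_induct)
    case base
    then show ?case by (simp add: sum_distrib_left zero_le_power_int)
  next
    case (step n)
    have "padic_norm (padic_p powi \<gamma> * (of_nat (d n) * padic_p ^ n) :: 'p padic)
        = padic_norm (of_nat (d n) :: 'p padic) * real CARD('p) powi (- \<gamma> - int n)"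
      using p1 by (simp add: padic_norm_mult padic_norm_p_powi padic_norm_p_power power_int_diff)
    also have "\<dots> \<le> 1 * real CARD('p) powi (- \<gamma> - int K)"
      using step(1) by (intro mult_mono padic_norm_of_nat_le_1) (auto simp: zero_le_power_int)
    finally have "padic_norm (padic_p powi \<gamma> * (of_nat (d n) * padic_p ^ n) :: 'p padic)
       \<le> real CARD('p) powi (- \<gamma> - int K)" by simp
    from padic_norm_add_le[OF step.IH this] show ?case by (simp add: algebra_simps)
  qed
qed simp

text \<open>Turns the definite description into a usable criterion. Cutting any expansion of
  \<open>x\<close> before p^0 yields a fraction in [0, 1) congruent to \<open>x\<close> modulo Z_p,
  and \<open>fraction_unique\<close> identifies it with j / p^k. Elements of Z_p, where the
  definition prescribes 0, obey the same rule.\<close>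

lemma padic_frac_eq:
  fixes x :: "'p::prime_card padic"
  assumes j: "j < CARD('p) ^ k" and le: "padic_norm (x - of_nat j / padic_p ^ k) \<le> 1"
  shows "padic_frac x = real j / real CARD('p) ^ k"
proof (cases "padic_norm x \<le> 1")
  case True
  have "padic_norm (of_nat j / padic_p ^ k :: 'p padic) \<le> 1"
    using padic_norm_diff_le[OF True le] by simp
  then have "real j / real CARD('p) ^ k = real 0 / real CARD('p) ^ 0"
    using fraction_unique[of j k 0 0, where 'p='p] j by simp
  then show ?thesis using True by (simp add: padic_frac_def)
next
  case False
  have p1: "real CARD('p) > 1" by (rule card_gt_1)
  let ?Q = "\<lambda>r. \<exists>\<gamma> d. is_padic_expansion x \<gamma> d \<and>
        r = real CARD('p) powi \<gamma> * (\<Sum>j<nat \<bar>\<gamma>\<bar>. real (d j) * real CARD('p) ^ j)"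
  have uniq: "r = real j / real CARD('p) ^ k" if "?Q r" for r
  proof -
    obtain \<gamma> d where ex: "is_padic_expansion x \<gamma> d"
      and r: "r = real CARD('p) powi \<gamma> * (\<Sum>j<nat \<bar>\<gamma>\<bar>. real (d j) * real CARD('p) ^ j)"
      using \<open>?Q r\<close> by blast
    \<comment> \<open>With \<gamma> >= 0 the tail bound for the empty partial sum would put
      \<open>x\<close> in Z_p.\<close>
    have "\<not> real CARD('p) powi (- \<gamma>) \<le> real CARD('p) powi 0"
      using padic_expansion_tail[OF ex, of 0] False by auto
    then have neg: "\<gamma> < 0" unfolding card_powi_le_iff by simp
    define K where "K = nat \<bar>\<gamma>\<bar>"
    have g: "\<gamma> = - int K" using neg by (simp add: K_def)
    define J where "J = (\<Sum>j<K. d j * CARD('p) ^ j)"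
    \<comment> \<open>With K = -\<gamma> the exponent in the tail bound is 0.\<close>
    have "padic_norm (x - of_nat J / padic_p ^ K) \<le> 1"
      using padic_expansion_tail[OF ex, of K]
      by (simp add: g J_def power_int_minus divide_inverse mult.commute)
    then have "padic_norm (of_nat J / padic_p ^ K - of_nat j / padic_p ^ k :: 'p padic) \<le> 1"
      using padic_norm_diff_le[OF le, of "x - of_nat J / padic_p ^ K"] by simp
    moreover have "J < CARD('p) ^ K"
      using ex unfolding J_def is_padic_expansion_def by (intro digit_sum_less) auto
    ultimately have "real J / real CARD('p) ^ K = real j / real CARD('p) ^ k"
      using fraction_unique[of J K j k, where 'p='p] j by blast
    moreover have "r = real J / real CARD('p) ^ K"
      unfolding r K_def[symmetric] by (simp add: g J_def power_int_minus divide_inverse mult.commute)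
    ultimately show ?thesis by simp
  qed
  have "x \<noteq> 0" using False by auto
  then obtain r where r: "?Q r" using padic_expansion_exists[of x] by blast
  have "(THE r. ?Q r) = real j / real CARD('p) ^ k"
  proof (rule the_equality)
    show "?Q (real j / real CARD('p) ^ k)" using r unfolding uniq[OF r] .
  qed (rule uniq)
  then show ?thesis using False by (simp add: padic_frac_def)
qed

text \<open>The numerator may be any integer: reducing it modulo p^k changes the exponent by an
  integer multiple of 2 pi i, which the exponential ignores. This freedom makes the character
  additive although \<open>padic_frac\<close> is not.\<close>

lemma padic_char_eq:
  fixes x :: "'p::prime_card padic"
  assumes "padic_norm (x - of_int z / padic_p ^ k) \<le> 1"
  shows "padic_char x = exp (2 * of_real pi * \<i> * of_real (of_int z / real CARD('p) ^ k))"
proof -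
  define q where "q = int CARD('p) ^ k"
  have p0: "real CARD('p) > 0" using card_gt_1[where 'p='p] by linarith
  have q0: "q > 0" using p0 by (simp add: q_def)
  define j where "j = nat (z mod q)"
  have jz: "int j = z mod q" using q0 by (simp add: j_def)
  have "int j < int (CARD('p) ^ k)" using jz q0 by (simp add: q_def)
  then have j: "j < CARD('p) ^ k" by (simp only: of_nat_less_iff)
  have zq: "z = q * (z div q) + int j" using jz by simp
  have "(of_int z :: 'p padic) = padic_p ^ k * of_int (z div q) + of_nat j"
    by (subst zq) (simp add: q_def)
  then have "of_int z / padic_p ^ k = (of_int (z div q) + of_nat j / padic_p ^ k :: 'p padic)"
    using padic_p_nonzero[where 'p='p] by (simp add: field_simps)
  then have "padic_norm (x - of_nat j / padic_p ^ k) \<le> 1"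
    using padic_norm_add_le[OF assms padic_norm_of_int_le_1[of "z div q"]] by simp
  then have frac: "padic_frac x = real j / real CARD('p) ^ k"
    by (rule padic_frac_eq[OF j])
  have "real_of_int z = real CARD('p) ^ k * of_int (z div q) + real j"
    by (subst zq) (simp add: q_def)
  then have "of_int z / real CARD('p) ^ k = padic_frac x + of_int (z div q)"
    using p0 by (simp add: frac field_simps)
  then have "2 * of_real pi * \<i> * of_real (of_int z / real CARD('p) ^ k)
     = 2 * of_real pi * \<i> * of_real (padic_frac x) + of_int (2 * (z div q)) * of_real pi * \<i>"
    by (simp add: algebra_simps)
  then have "exp (2 * of_real pi * \<i> * of_real (of_int z / real CARD('p) ^ k))
     = exp (2 * of_real pi * \<i> * of_real (padic_frac x) + of_int (2 * (z div q)) * of_real pi * \<i>)"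
    by (rule arg_cong)
  also have "\<dots> = padic_char x"
    unfolding padic_char_def exp_eq by (intro exI[of _ "z div q"]) simp
  finally show ?thesis by simp
qed

lemma padic_char_add: "padic_char (x + y) = padic_char x * padic_char y"
proof -
  obtain j k where j: "padic_norm (x - of_nat j / padic_p ^ k) \<le> 1" by (rule fraction_exists)
  obtain i l where i: "padic_norm (y - of_nat i / padic_p ^ l) \<le> 1" by (rule fraction_exists)
  define z where "z = int j * int CARD('a) ^ l + int i * int CARD('a) ^ k"
  have p0: "real CARD('a) > 0" using card_gt_1[where 'p='a] by linarith
  have "of_int z / padic_p ^ (k + l) = (of_nat j / padic_p ^ k + of_nat i / padic_p ^ l :: 'a padic)"
    using padic_p_nonzero[where 'p='a] by (simp add: z_def field_simps power_add)
  then have "x + y - of_int z / padic_p ^ (k + l)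
      = (x - of_nat j / padic_p ^ k) + (y - of_nat i / padic_p ^ l)" by simp
  then have "padic_norm (x + y - of_int z / padic_p ^ (k + l)) \<le> 1"
    using padic_norm_add_le[OF j i] by metis
  note e = padic_char_eq[OF this] padic_char_eq[of x "int j" k] padic_char_eq[of y "int i" l]
  have "of_int z / real CARD('a) ^ (k + l) = of_int (int j) / real CARD('a) ^ k + of_int (int i) / real CARD('a) ^ l"
    using p0 by (simp add: z_def field_simps power_add)
  then show ?thesis
    using j i e by (simp add: distrib_left exp_add)
qed

text \<open>With \<open>x\<close> congruent to j / p^k modulo Z_p, the value is 1 iff j / p^k is an
  integer, i.e. iff p^k divides j, which says that j / p^k lies in Z_p. One direction makes
  characters locally constant, the other makes their integrals over large balls vanish.\<close>

lemma padic_char_eq_1_iff: "padic_char x = 1 \<longleftrightarrow> padic_norm x \<le> 1"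
proof -
  obtain j k where j: "padic_norm (x - of_nat j / padic_p ^ k) \<le> 1" by (rule fraction_exists)
  have p0: "real CARD('a) > 0" using card_gt_1[where 'p='a] by linarith
  have "padic_char x = 1 \<longleftrightarrow> (\<exists>n::int. real j / real CARD('a) ^ k = of_int n)"
  proof -
    have *: "2 * pi * r = of_int (2 * n) * pi \<longleftrightarrow> r = of_int n" for r and n :: int
      by auto
    have "padic_char x = exp (2 * of_real pi * \<i> * of_real (real j / real CARD('a) ^ k))"
      using padic_char_eq[of x "int j" k] j by simp
    also have "\<dots> = 1 \<longleftrightarrow> (\<exists>n::int. 2 * pi * (real j / real CARD('a) ^ k) = of_int (2 * n) * pi)"
      by (subst exp_eq_1) simp
    finally show ?thesis unfolding * .
  qed
  also have "\<dots> \<longleftrightarrow> (\<exists>n::int. real j = real CARD('a) ^ k * of_int n)"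
    using p0 by (simp add: field_simps)
  also have "\<dots> \<longleftrightarrow> (\<exists>n::int. real_of_int (int j) = of_int (int CARD('a) ^ k * n))"
    by simp
  also have "\<dots> \<longleftrightarrow> int CARD('a) ^ k dvd int j"
    unfolding of_int_eq_iff dvd_def ..
  also have "\<dots> \<longleftrightarrow> padic_norm (of_nat j / padic_p ^ k :: 'a padic) \<le> 1"
    using padic_norm_int_div_p_power_le_1_iff[of "int j" k, where 'p='a] by simp
  also have "\<dots> \<longleftrightarrow> padic_norm x \<le> 1"
    using padic_norm_add_le[OF j, of "of_nat j / padic_p ^ k"]
      padic_norm_diff_le[OF _ j, of x] by auto
  finally show ?thesis .
qed

lemma padic_char_0 [simp]: "padic_char 0 = 1"
  by (simp add: padic_char_eq_1_iff)

lemma cmod_padic_char [simp]: "cmod (padic_char x) = 1"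
  by (simp add: padic_char_def norm_exp_eq_Re)

lemma padic_char_nonzero [simp]: "padic_char x \<noteq> 0"
  using cmod_padic_char[of x] by force

lemma padic_char_minus: "padic_char (- x) = cnj (padic_char x)"
proof -
  have "padic_char (- x) * padic_char x = cnj (padic_char x) * padic_char x"
    using padic_char_add[of "- x" x] complex_norm_square[of "padic_char x"]
    by (simp add: mult.commute)
  then show ?thesis by simp
qed

lemma padic_char_diff: "padic_char (x - y) = padic_char x * cnj (padic_char y)"
  using padic_char_add[of x "- y"] by (simp add: padic_char_minus)

lemma padic_char_cong: "padic_norm (x - y) \<le> 1 \<Longrightarrow> padic_char x = padic_char y"
  using padic_char_add[of "x - y" y] by (simp add: padic_char_eq_1_iff)

lemma padic_char_of_nat_mult: "padic_char (of_nat n * x) = padic_char x ^ n"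
  by (induction n) (simp_all add: distrib_right padic_char_add)

section \<open>Balls and Haar measure\<close>

lemma card_powi_mult_le_1_iff:
  "real CARD('p::prime_card) powi (- n) * t \<le> 1 \<longleftrightarrow> t \<le> real CARD('p) powi n"
  using card_powi_pos[of n, where 'p='p] by (simp add: power_int_minus field_simps)

text \<open>The index is minus the exponent of the radius, so a larger \<open>n\<close> means a
  smaller ball; every ball is a coset of p^n Z_p.\<close>

definition padic_ball :: "'p::prime_card padic \<Rightarrow> int \<Rightarrow> 'p padic set" where
  "padic_ball c n = {x. padic_norm (x - c) \<le> real CARD('p) powi (- n)}"

lemma padic_ball_mono: "n \<le> k \<Longrightarrow> padic_ball c k \<subseteq> padic_ball c n"
  unfolding padic_ball_def using card_powi_le_iff[of "- k" "- n"] by (auto intro: order_trans)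

lemma padic_ball_center [simp]: "c \<in> padic_ball c n"
  by (simp add: padic_ball_def zero_le_power_int)

text \<open>Every point of an ultrametric ball is a centre; nestedness and openness of balls both
  come from this.\<close>

lemma padic_ball_eq:
  assumes "c \<in> padic_ball d n"
  shows "padic_ball c n = padic_ball d n"
proof -
  have c: "padic_norm (c - d) \<le> real CARD('a) powi (- n)" using assms by (simp add: padic_ball_def)
  show ?thesis
  proof (intro Set.set_eqI iffI)
    fix x assume "x \<in> padic_ball c n"
    then have "padic_norm (x - c + (c - d)) \<le> real CARD('a) powi (- n)"
      using c by (intro padic_norm_add_le) (auto simp: padic_ball_def)
    then show "x \<in> padic_ball d n" by (simp add: padic_ball_def)
  next
    fix x assume "x \<in> padic_ball d n"
    then have "padic_norm (x - d) \<le> real CARD('a) powi (- n)" by (simp add: padic_ball_def)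
    from padic_norm_diff_le[OF this c] have "padic_norm (x - d - (c - d)) \<le> real CARD('a) powi (- n)" .
    then show "x \<in> padic_ball c n" by (simp add: padic_ball_def)
  qed
qed

lemma padic_ball_nested:
  assumes "n \<le> k"
  shows "padic_ball c k \<subseteq> padic_ball d n \<or> padic_ball c k \<inter> padic_ball d n = {}"
proof (cases "padic_ball c k \<inter> padic_ball d n = {}")
  case False
  then obtain x where "x \<in> padic_ball c k" "x \<in> padic_ball d n" by blast
  then show ?thesis
    using padic_ball_mono[OF assms, of x] by (simp add: padic_ball_eq)
qed simp

lemma padic_ball_translate: "(+) a ` padic_ball c n = padic_ball (a + c) n"
proof (intro Set.set_eqI iffI)
  fix x assume "x \<in> padic_ball (a + c) n"
  then show "x \<in> (+) a ` padic_ball c n"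
    by (intro image_eqI[of _ _ "x - a"]) (auto simp: padic_ball_def algebra_simps)
qed (auto simp: padic_ball_def)

lemma padic_ball_subset_open:
  assumes "open U" "x \<in> U"
  shows "\<exists>n. padic_ball x n \<subseteq> U"
proof -
  obtain e where e: "e > 0" "\<And>y. dist y x < e \<Longrightarrow> y \<in> U"
    using assms unfolding open_dist by blast
  have "1 / real CARD('a) < 1" using card_gt_1[where 'p='a] by simp
  then obtain n where n: "(1 / real CARD('a)) ^ n < e"
    using real_arch_pow_inv[OF e(1)] by blast
  have "padic_ball x (int n) \<subseteq> U"
    using n by (auto intro!: e(2) simp: padic_ball_def dist_padic_def power_int_minus divide_inverse power_inverse)
  then show ?thesis ..
qed

lemma open_padic_ball: "open (padic_ball c n)"
  unfolding open_dist
proof (intro ballI exI conjI allI impI)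
  fix x y assume x: "x \<in> padic_ball c n" and y: "dist y x < real CARD('a) powi (- n)"
  then have "y \<in> padic_ball x n" by (simp add: padic_ball_def dist_padic_def)
  then show "y \<in> padic_ball c n" unfolding padic_ball_eq[OF x] .
qed simp

lemma padic_ball_borel [measurable]: "padic_ball c n \<in> sets borel"
  by (simp add: open_padic_ball)

text \<open>p^n Z_p splits into the p cosets of p^(n+1) Z_p: divide by p^n and take the residue
  modulo p. Translation invariance will make their measures equal.\<close>

lemma padic_ball_decompose:
  "padic_ball (0 :: 'p::prime_card padic) n
    = (\<Union>d<CARD('p). padic_ball (padic_p powi n * of_nat d) (n + 1))"
proof (intro Set.set_eqI iffI)
  have p1: "real CARD('p) > 1" by (rule card_gt_1)
  fix x :: "'p padic"
  assume "x \<in> padic_ball 0 n"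
  then have x: "padic_norm x \<le> real CARD('p) powi (- n)" by (simp add: padic_ball_def)
  have "padic_norm (padic_p powi (- n) * x) = real CARD('p) powi n * padic_norm x"
    by (simp add: padic_norm_mult padic_norm_p_powi)
  also have "\<dots> \<le> real CARD('p) powi n * real CARD('p) powi (- n)"
    using x by (intro mult_left_mono) (auto simp: zero_le_power_int)
  also have "\<dots> = 1" using p1 by (simp add: power_int_minus)
  finally obtain d where d: "d < CARD('p)"
      "padic_norm (padic_p powi (- n) * x - of_nat d) \<le> 1 / real CARD('p)"
    by (rule residue_exists)
  define r where "r = padic_p powi (- n) * x - of_nat d"
  have "x - padic_p powi n * of_nat d = padic_p powi n * r"
    using padic_p_nonzero[where 'p='p] by (simp add: r_def right_diff_distrib power_int_minus)
  then have "padic_norm (x - padic_p powi n * of_nat d) = real CARD('p) powi (- n) * padic_norm r"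
    by (simp add: padic_norm_mult padic_norm_p_powi)
  also have "\<dots> \<le> real CARD('p) powi (- n) * (1 / real CARD('p))"
    using d(2) by (intro mult_left_mono) (auto simp: r_def zero_le_power_int)
  also have "\<dots> = real CARD('p) powi (- (n + 1))"
    using p1 by (simp add: power_int_minus power_int_diff field_simps)
  finally show "x \<in> (\<Union>d<CARD('p). padic_ball (padic_p powi n * of_nat d) (n + 1))"
    using d(1) by (auto simp: padic_ball_def)
next
  fix x :: "'p padic"
  assume "x \<in> (\<Union>d<CARD('p). padic_ball (padic_p powi n * of_nat d) (n + 1))"
  then obtain d where "x \<in> padic_ball (padic_p powi n * of_nat d) (n + 1)" by blast
  then have x: "x \<in> padic_ball (padic_p powi n * of_nat d) n"
    using padic_ball_mono[of n "n + 1"] by auto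
  have "padic_norm (padic_p powi n * of_nat d :: 'p padic) \<le> real CARD('p) powi (- n) * 1"
    unfolding padic_norm_mult padic_norm_p_powi
    by (intro mult_left_mono padic_norm_of_nat_le_1) (simp add: zero_le_power_int)
  then have "padic_p powi n * of_nat d \<in> padic_ball (0 :: 'p padic) n"
    by (simp add: padic_ball_def)
  from padic_ball_eq[OF this] x show "x \<in> padic_ball 0 n" by simp
qed

lemma padic_ball_decompose_disjoint:
  "disjoint_family_on (\<lambda>d. padic_ball (padic_p powi n * of_nat d :: 'p::prime_card padic) (n + 1)) {..<CARD('p)}"
  unfolding disjoint_family_on_def
proof (intro ballI impI)
  have p1: "real CARD('p) > 1" by (rule card_gt_1)
  fix d e assume de: "d \<in> {..<CARD('p)}" "e \<in> {..<CARD('p)}" "d \<noteq> e"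
  show "padic_ball (padic_p powi n * of_nat d :: 'p padic) (n + 1)
      \<inter> padic_ball (padic_p powi n * of_nat e) (n + 1) = {}"
  proof (rule ccontr)
    assume "\<not> ?thesis"
    then have "padic_ball (padic_p powi n * of_nat d :: 'p padic) (n + 1)
      = padic_ball (padic_p powi n * of_nat e) (n + 1)"
      using padic_ball_eq by blast
    then have "padic_p powi n * of_nat d \<in> padic_ball (padic_p powi n * of_nat e :: 'p padic) (n + 1)"
      using padic_ball_center by blast
    then have "padic_norm (padic_p powi n * of_int (int d - int e) :: 'p padic) \<le> real CARD('p) powi (- (n + 1))"
      by (simp add: padic_ball_def right_diff_distrib)
    also have "\<dots> = real CARD('p) powi (- n) * real CARD('p) powi (- int 1)"
      using p1 by (simp add: power_int_minus power_int_diff field_simps)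
    finally have "padic_norm (of_int (int d - int e) :: 'p padic) \<le> real CARD('p) powi (- int 1)"
      unfolding padic_norm_mult padic_norm_p_powi by (subst (asm) mult_le_cancel_left_pos) auto
    then have "int CARD('p) dvd \<bar>int d - int e\<bar>" unfolding padic_norm_of_int_le_iff by simp
    moreover have "0 < \<bar>int d - int e\<bar>" "\<bar>int d - int e\<bar> < int CARD('p)" using de by auto
    ultimately show False using zdvd_not_zless by blast
  qed
qed

section \<open>Measurability of characters and translations\<close>

lemma borel_measurable_locally_constant:
  fixes f :: "'a::metric_space \<Rightarrow> 'b::topological_space"
  assumes "\<And>x. \<exists>e>0. \<forall>y. dist y x < e \<longrightarrow> f y = f x"
  shows "f \<in> borel_measurable borel"
proof (rule borel_measurable_continuous_onI)
  have "isCont f x" for x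
  proof -
    obtain e where "e > 0" "\<forall>y. dist y x < e \<longrightarrow> f y = f x" using assms by blast
    then have "eventually (\<lambda>y. f y = f x) (at x)"
      unfolding eventually_at by blast
    then show ?thesis unfolding isCont_def by (rule tendsto_eventually)
  qed
  then show "continuous_on UNIV f" by (simp add: continuous_at_imp_continuous_on)
qed

lemma padic_char_borel [measurable]: "(\<lambda>x. padic_char (b * x)) \<in> borel_measurable borel"
proof (rule borel_measurable_locally_constant, intro exI conjI allI impI)
  \<comment> \<open>The summand 1 keeps the radius meaningful for \<open>b = 0\<close>; within it |b
    (y - x)| <= 1, so the character does not change.\<close>
  fix x y :: "'a padic" assume "dist y x < 1 / (padic_norm b + 1)"
  then have "padic_norm (y - x) * (padic_norm b + 1) \<le> 1"
    using padic_norm_nonneg[of b] by (simp add: dist_padic_def field_simps add_nonneg_eq_0_iff)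
  then have "padic_norm (b * y - b * x) \<le> 1"
    unfolding right_diff_distrib[symmetric] padic_norm_mult distrib_left
    using padic_norm_nonneg[of "y - x"] by (simp add: mult.commute del: padic_norm_nonneg)
  then show "padic_char (b * y) = padic_char (b * x)" by (rule padic_char_cong)
next
  show "0 < 1 / (padic_norm b + 1)" using padic_norm_nonneg[of b] by (simp add: add_nonneg_pos)
qed

lemma translate_borel [measurable]: "(+) (a :: 'p::prime_card padic) \<in> borel_measurable borel"
proof (rule borel_measurable_continuous_onI)
  show "continuous_on UNIV ((+) a)"
    unfolding continuous_on_iff by (auto simp: dist_padic_def)
qed

section \<open>Integration against Haar measure\<close>

locale padic_haar =
  fixes M :: "'p::prime_card padic measure"
  assumes haar: "normalized_padic_haar M"
begin

lemma sets_M [simp, measurable_cong]: "sets M = sets borel"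
  using haar by (simp add: normalized_padic_haar_def)

lemma space_M [simp]: "space M = UNIV"
  using sets_eq_imp_space_eq[OF sets_M] by simp

text \<open>The invariance hypothesis concerns image sets; stated for the pushforward measure it
  yields a change of variables for integrals.\<close>

lemma distr_translate: "distr M borel ((+) a) = M"
proof (rule measure_eqI)
  fix A assume "A \<in> sets (distr M borel ((+) a))"
  then have A[measurable]: "A \<in> sets borel" by simp
  have "(+) a -` A = (+) (- a) ` A"
    by (auto intro!: image_eqI[of _ _ "a + _"])
  moreover have "emeasure M ((+) (- a) ` A) = emeasure M A"
    using haar A unfolding normalized_padic_haar_def by blast
  ultimately have "emeasure M ((+) a -` A) = emeasure M A" by simp
  then show "emeasure (distr M borel ((+) a)) A = emeasure M A"
    by (subst emeasure_distr) auto
qed simp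

lemma integral_translate:
  fixes f :: "'p padic \<Rightarrow> complex"
  assumes [measurable]: "f \<in> borel_measurable borel"
  shows "(LINT x|M. f (a + x)) = (LINT x|M. f x)"
proof -
  have "(LINT x|M. f x) = (LINT x|distr M borel ((+) a). f x)" by (simp add: distr_translate)
  also have "\<dots> = (LINT x|M. f (a + x))" by (rule integral_distr) auto
  finally show ?thesis ..
qed

lemma emeasure_ball_center: "emeasure M (padic_ball c n) = emeasure M (padic_ball 0 n)"
  using haar padic_ball_borel[of 0 n] padic_ball_translate[of c 0 n]
  unfolding normalized_padic_haar_def by (metis add.right_neutral)

lemma emeasure_ball_Suc:
  "emeasure M (padic_ball 0 n) = ennreal (real CARD('p)) * emeasure M (padic_ball 0 (n + 1))"
proof -
  have "emeasure M (padic_ball 0 n)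
      = (\<Sum>d<CARD('p). emeasure M (padic_ball (padic_p powi n * of_nat d) (n + 1)))"
    unfolding padic_ball_decompose
    by (intro sum_emeasure[symmetric] padic_ball_decompose_disjoint) auto
  also have "\<dots> = (\<Sum>d<CARD('p). emeasure M (padic_ball 0 (n + 1)))"
    by (intro sum.cong refl emeasure_ball_center)
  finally show ?thesis by (simp add: ennreal_of_nat_eq_real_of_nat)
qed

text \<open>The normalization fixes n = 0. Smaller balls follow by cancelling the factor p in
  \<open>emeasure_ball_Suc\<close>, larger ones by multiplying with it; hence the induction in both
  directions.\<close>

lemma emeasure_ball: "emeasure M (padic_ball c n) = ennreal (real CARD('p) powi (- n))"
proof -
  have p1: "real CARD('p) > 1" by (rule card_gt_1)
  have "emeasure M (padic_ball 0 n) = ennreal (real CARD('p) powi (- n))"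
  proof (induction n rule: int_induct[where k = 0])
    case base
    have "padic_ball 0 0 = {x :: 'p padic. padic_norm x \<le> 1}" by (simp add: padic_ball_def)
    then show ?case using haar by (simp add: normalized_padic_haar_def)
  next
    case (step1 i)
    have "ennreal (real CARD('p)) * emeasure M (padic_ball 0 (i + 1)) = ennreal (real CARD('p) powi (- i))"
      using step1 emeasure_ball_Suc[of i] by simp
    also have "real CARD('p) powi (- i) = real CARD('p) * real CARD('p) powi (- (i + 1))"
      using p1 by (simp add: power_int_minus power_int_diff field_simps)
    also have "ennreal \<dots> = ennreal (real CARD('p)) * ennreal (real CARD('p) powi (- (i + 1)))"
      by (rule ennreal_mult') simp
    finally show ?case using p1 by (auto simp: ennreal_mult_cancel_left)
  next
    case (step2 i)
    have "emeasure M (padic_ball 0 (i - 1)) = ennreal (real CARD('p)) * ennreal (real CARD('p) powi (- i))"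
      using step2 emeasure_ball_Suc[of "i - 1"] by simp
    also have "\<dots> = ennreal (real CARD('p) * real CARD('p) powi (- i))"
      by (rule ennreal_mult'[symmetric]) simp
    also have "real CARD('p) * real CARD('p) powi (- i) = real CARD('p) powi (- (i - 1))"
      using p1 by (simp add: power_int_minus power_int_diff divide_inverse)
    finally show ?case .
  qed
  then show ?thesis by (simp add: emeasure_ball_center[of c])
qed

lemma measure_ball: "measure M (padic_ball c n) = real CARD('p) powi (- n)"
  by (simp add: measure_def emeasure_ball zero_le_power_int)

text \<open>The origin will be the only point outside all wavelet balls, so completeness needs it to
  be negligible. It lies in balls of measure p^(-n) for all n.\<close>

lemma emeasure_zero: "emeasure M {0} = 0"
proof -
  have "emeasure M {0} \<le> ennreal (inverse (real CARD('p)) ^ n)" for n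
  proof -
    have "emeasure M {0} \<le> emeasure M (padic_ball 0 (int n))"
      by (rule emeasure_mono) auto
    then show ?thesis by (simp add: emeasure_ball power_int_minus power_inverse)
  qed
  moreover have "(\<lambda>n. ennreal (inverse (real CARD('p)) ^ n)) \<longlonglongrightarrow> ennreal 0"
    using card_gt_1[where 'p='p] by (intro tendsto_ennrealI LIMSEQ_realpow_zero) (auto simp: inverse_less_1_iff)
  ultimately have "emeasure M {0} \<le> ennreal 0" by (intro LIMSEQ_le_const) auto
  then show ?thesis by simp
qed

text \<open>On the ball |b (x - c)| <= |b| p^(-n). If this bound is at most 1 the character is
  constant; otherwise a translation preserving the ball multiplies the integral by a factor
  different from 1.\<close>

lemma integral_char_ball:
  "(LINT x|M. padic_char (b * x) * indicator (padic_ball c n) x)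
    = (if padic_norm b \<le> real CARD('p) powi n
       then of_real (real CARD('p) powi (- n)) * padic_char (b * c) else 0)"
proof (cases "padic_norm b \<le> real CARD('p) powi n")
  case True
  have p1: "real CARD('p) > 1" by (rule card_gt_1)
  have eq: "padic_char (b * x) = padic_char (b * c)" if "x \<in> padic_ball c n" for x
  proof (rule padic_char_cong)
    have "padic_norm (b * x - b * c) = padic_norm b * padic_norm (x - c)"
      by (simp flip: padic_norm_mult right_diff_distrib)
    also have "\<dots> \<le> real CARD('p) powi n * real CARD('p) powi (- n)"
      using True that by (intro mult_mono) (auto simp: padic_ball_def zero_le_power_int)
    also have "\<dots> = 1" using p1 by (simp add: power_int_minus)
    finally show "padic_norm (b * x - b * c) \<le> 1" .
  qed
  have eq2: "padic_char (b * x) * indicator (padic_ball c n) x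
      = indicat_real (padic_ball c n) x *\<^sub>R padic_char (b * c)" for x
  proof (cases "x \<in> padic_ball c n")
    case True
    then show ?thesis unfolding eq[OF True] by simp
  qed simp
  have "(LINT x|M. padic_char (b * x) * indicator (padic_ball c n) x)
      = measure M (padic_ball c n) *\<^sub>R padic_char (b * c)"
    unfolding eq2
    by (intro has_bochner_integral_integral_eq has_bochner_integral_indicator) (simp_all add: emeasure_ball)
  then show ?thesis using True by (simp add: measure_ball scaleR_conv_of_real)
next
  case False
  let ?f = "\<lambda>x. padic_char (b * x) * indicator (padic_ball c n) x"
  \<comment> \<open>An element of maximal norm among the translations preserving the ball: |b h| =
    |b| p^(-n) > 1, so its character value is not 1.\<close>
  define h :: "'p padic" where "h = padic_p powi n"
  have [measurable]: "?f \<in> borel_measurable borel" by measurable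
  have "h + x \<in> padic_ball c n \<longleftrightarrow> x \<in> padic_ball c n" for x
  proof -
    have "h + x \<in> padic_ball x n"
      by (simp add: padic_ball_def h_def padic_norm_p_powi)
    then show ?thesis by (metis padic_ball_center padic_ball_eq)
  qed
  then have shift: "?f (h + x) = padic_char (b * h) * ?f x" for x
    by (simp add: indicator_def distrib_left padic_char_add)
  have "(LINT x|M. ?f x) = (LINT x|M. ?f (h + x))"
    by (rule integral_translate[symmetric]) measurable
  also have "\<dots> = padic_char (b * h) * (LINT x|M. ?f x)" unfolding shift by simp
  finally have "(1 - padic_char (b * h)) * (LINT x|M. ?f x) = 0" by (simp add: left_diff_distrib)
  moreover have "padic_char (b * h) \<noteq> 1"
    unfolding padic_char_eq_1_iff h_def padic_norm_mult padic_norm_p_powi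
    using False card_gt_1[where 'p='p] by (simp add: power_int_minus field_simps)
  ultimately show ?thesis using False by simp
qed

end

section \<open>The orthonormal system\<close>

lemma padic_I_eq: "(padic_I :: 'p::prime_card padic set) = {of_nat j / padic_p ^ k |j k. j < CARD('p) ^ k}"
proof (intro Set.set_eqI iffI)
  fix x :: "'p padic"
  assume "x \<in> padic_I"
  then obtain k a where x: "x = padic_p powi (- int k) * (\<Sum>j<k. of_nat (a j) * padic_p ^ j)"
    and a: "\<forall>j<k. a j < CARD('p)" unfolding padic_I_def by blast
  have "x = of_nat (\<Sum>j<k. a j * CARD('p) ^ j) / padic_p ^ k"
    by (simp add: x power_int_minus divide_inverse mult.commute)
  moreover have "(\<Sum>j<k. a j * CARD('p) ^ j) < CARD('p) ^ k"
    using a by (intro digit_sum_less) auto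
  ultimately show "x \<in> {of_nat j / padic_p ^ k |j k. j < CARD('p) ^ k}" by blast
next
  fix x :: "'p padic"
  assume "x \<in> {of_nat j / padic_p ^ k |j k. j < CARD('p) ^ k}"
  then obtain j k where x: "x = of_nat j / padic_p ^ k" and j: "j < CARD('p) ^ k" by blast
  have p0: "CARD('p) > 0" using card_gt_1[where 'p='p] by linarith
  \<comment> \<open>\<open>k\<close> may be 0 here while \<open>padic_I\<close> demands at least one
    digit, so the fraction is expanded by p.\<close>
  have x': "x = of_nat (j * CARD('p)) / padic_p ^ Suc k"
    using padic_p_nonzero[where 'p='p] by (simp add: x)
  have "j * CARD('p) < CARD('p) ^ Suc k" using j p0 by simp
  then obtain d where d: "\<forall>i. d i < CARD('p)" "j * CARD('p) = (\<Sum>i<Suc k. d i * CARD('p) ^ i)"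
    using digits_exist p0 by meson
  have "x = padic_p powi (- int (Suc k)) * (\<Sum>i<Suc k. of_nat (d i) * padic_p ^ i)"
    unfolding x' d(2) power_int_minus power_int_of_nat
    by (simp add: divide_inverse mult.commute del: sum.lessThan_Suc power_Suc)
  then show "x \<in> padic_I" unfolding padic_I_def using d(1) by (intro CollectI exI[of _ "Suc k"] exI[of _ d]) auto
qed

text \<open>All digits but the lowest contribute multiples of p, so a nonzero lowest digit means
  that p does not divide the numerator. The hypothesis on \<open>m\<close> ensures that digit 0
  belongs to the sum.\<close>

lemma padic_J_eq:
  assumes "m \<ge> 1"
  shows "(padic_J m :: 'p::prime_card padic set)
    = {of_nat j / padic_p ^ m |j. j < CARD('p) ^ m \<and> \<not> CARD('p) dvd j}"
proof -
  have p0: "CARD('p) > 0" using card_gt_1[where 'p='p] by linarith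
  have dvd: "CARD('p) dvd (\<Sum>i<m. d i * CARD('p) ^ i) \<longleftrightarrow> d 0 = 0" if "d 0 < CARD('p)" for d
  proof -
    obtain l where m: "m = Suc l" using assms by (cases m) auto
    have "CARD('p) dvd (\<Sum>i<l. d (Suc i) * CARD('p) ^ Suc i)" by (intro dvd_sum) simp
    then have "CARD('p) dvd (\<Sum>i<m. d i * CARD('p) ^ i) \<longleftrightarrow> CARD('p) dvd d 0"
      unfolding m sum.lessThan_Suc_shift by (simp add: dvd_add_left_iff)
    then show ?thesis using that by (auto dest: dvd_imp_le)
  qed
  have eq: "padic_p powi (- int m) * (\<Sum>i<m. of_nat (d i) * padic_p ^ i)
      = (of_nat (\<Sum>i<m. d i * CARD('p) ^ i) / padic_p ^ m :: 'p padic)" for d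
    by (simp add: power_int_minus divide_inverse mult.commute)
  show ?thesis
  proof (intro Set.set_eqI iffI)
    fix x :: "'p padic"
    assume "x \<in> padic_J m"
    then obtain d where x: "x = of_nat (\<Sum>i<m. d i * CARD('p) ^ i) / padic_p ^ m"
      and d: "\<forall>j<m. d j < CARD('p)" "d 0 \<noteq> 0" unfolding padic_J_def eq by blast
    have "(\<Sum>j<m. d j * CARD('p) ^ j) < CARD('p) ^ m"
      using d by (intro digit_sum_less) auto
    moreover have "\<not> CARD('p) dvd (\<Sum>i<m. d i * CARD('p) ^ i)"
      using dvd[of d] d assms by auto
    ultimately show "x \<in> {of_nat j / padic_p ^ m |j. j < CARD('p) ^ m \<and> \<not> CARD('p) dvd j}"
      using x by blast
  next
    fix x :: "'p padic"
    assume "x \<in> {of_nat j / padic_p ^ m |j. j < CARD('p) ^ m \<and> \<not> CARD('p) dvd j}"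
    then obtain j where x: "x = of_nat j / padic_p ^ m" and j: "j < CARD('p) ^ m" "\<not> CARD('p) dvd j"
      by blast
    obtain d where d: "\<forall>i. d i < CARD('p)" "j = (\<Sum>i<m. d i * CARD('p) ^ i)"
      using digits_exist[OF j(1) p0] by blast
    have "d 0 \<noteq> 0" using dvd[of d] d j(2) by auto
    then show "x \<in> padic_J m" unfolding padic_J_def eq x d(2) using d(1) by blast
  qed
qed

text \<open>\<open>fraction_unique\<close> gives an equality of reals; clearing denominators turns
  it into an identity of naturals, which holds in Q_p as well.\<close>

lemma padic_I_unique:
  assumes "a \<in> padic_I" "b \<in> padic_I" "padic_norm (a - b) \<le> 1"
  shows "a = (b :: 'p::prime_card padic)"
proof -
  have p0: "real CARD('p) > 0" using card_gt_1[where 'p='p] by linarith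
  obtain j k where a: "a = of_nat j / padic_p ^ k" "j < CARD('p) ^ k"
    using assms(1) by (auto simp: padic_I_eq)
  obtain j' k' where b: "b = of_nat j' / padic_p ^ k'" "j' < CARD('p) ^ k'"
    using assms(2) by (auto simp: padic_I_eq)
  have "real j / real CARD('p) ^ k = real j' / real CARD('p) ^ k'"
    using fraction_unique[OF a(2) b(2)] assms(3) a b by simp
  then have "real (j * CARD('p) ^ k') = real (j' * CARD('p) ^ k)"
    using p0 by (simp add: field_simps)
  then have "j * CARD('p) ^ k' = j' * CARD('p) ^ k" by (simp only: of_nat_eq_iff)
  then have "of_nat (j * CARD('p) ^ k') = (of_nat (j' * CARD('p) ^ k) :: 'p padic)" by simp
  then show ?thesis using padic_p_nonzero[where 'p='p] by (simp add: a b field_simps)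
qed

lemma padic_J_subset_I: "m \<ge> 1 \<Longrightarrow> padic_J m \<subseteq> padic_I"
  unfolding padic_J_eq padic_I_eq by blast

lemma finite_padic_J: "m \<ge> 1 \<Longrightarrow> finite (padic_J m)"
  unfolding padic_J_eq by (rule finite_subset[of _ "(\<lambda>j. of_nat j / padic_p ^ m) ` {..<CARD('a) ^ m}"]) auto

lemma padic_norm_of_nat_eq_1:
  assumes "\<not> CARD('p::prime_card) dvd j"
  shows "padic_norm (of_nat j :: 'p padic) = 1"
proof -
  have "j \<noteq> 0" using assms dvd_0_right by metis
  moreover have "multiplicity (int CARD('p)) (int j) = 0"
    using assms by (intro not_dvd_imp_multiplicity_0) (simp add: int_dvd_int_iff)
  ultimately show ?thesis using padic_norm_of_int[of "int j", where 'p='p] by simp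
qed

lemma padic_norm_J:
  fixes s :: "'p::prime_card padic"
  assumes "m \<ge> 1" "s \<in> padic_J m"
  shows "padic_norm s = real CARD('p) powi (int m)"
  using assms by (auto simp: padic_J_eq padic_norm_div_p_power padic_norm_of_nat_eq_1)

text \<open>The numerator is a residue of p^m x modulo p^m. Were it divisible by p, the fraction
  would have norm less than p^m; but it is within distance 1 of \<open>x\<close> and so shares the
  norm of \<open>x\<close>, which exceeds 1.\<close>

lemma padic_J_exists:
  fixes x :: "'p::prime_card padic"
  assumes m: "m \<ge> 1" and x: "padic_norm x = real CARD('p) powi (int m)"
  obtains s where "s \<in> padic_J m" "padic_norm (x - s) \<le> 1"
proof -
  have p1: "real CARD('p) > 1" by (rule card_gt_1)
  have "padic_norm (x * padic_p ^ m) \<le> 1"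
    using p1 by (simp add: padic_norm_mult padic_norm_p_power x)
  then obtain j where j: "j < CARD('p) ^ m" "padic_norm (x * padic_p ^ m - of_nat j) \<le> 1 / real CARD('p) ^ m"
    using residue_power_exists by blast
  have "x - of_nat j / padic_p ^ m = (x * padic_p ^ m - of_nat j) / padic_p ^ m"
    using padic_p_nonzero[where 'p='p] by (simp add: field_simps)
  then have le: "padic_norm (x - of_nat j / padic_p ^ m) \<le> 1"
    using j(2) p1 by (simp add: padic_norm_div_p_power field_simps)
  have x1: "padic_norm x > 1" using p1 m by (simp add: x)
  have "\<not> CARD('p) dvd j"
  proof
    assume "CARD('p) dvd j"
    then have "int CARD('p) ^ 1 dvd int j" by simp
    then have "padic_norm (of_nat j :: 'p padic) \<le> 1 / real CARD('p)"
      using padic_norm_of_int_le_iff[of "int j" 1, where 'p='p]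
      by (simp add: power_int_minus divide_inverse)
    moreover have "1 / real CARD('p) < 1" using p1 by simp
    ultimately have "padic_norm (of_nat j :: 'p padic) < 1" by linarith
    moreover have "padic_norm (of_nat j / padic_p ^ m :: 'p padic) = padic_norm x"
      by (rule padic_norm_near[OF le_less_trans[OF le x1]])
    ultimately show False using p1 by (simp add: padic_norm_div_p_power x)
  qed
  then show ?thesis using that[of "of_nat j / padic_p ^ m"] le j(1) m by (auto simp: padic_J_eq)
qed

section \<open>Tiling of the punctured field by wavelet balls\<close>

definition padic_wavelet_ball :: "int \<Rightarrow> 'p::prime_card padic \<Rightarrow> 'p padic set" where
  "padic_wavelet_ball \<gamma> s = padic_ball (- (padic_p powi \<gamma> * s)) \<gamma>"

text \<open>Multiplying by p^\<gamma> solves the condition in the factor \<open>Omega\<close> for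
  \<xi>; this is where the centre and radius of the ball come from.\<close>

lemma padic_wavelet_ball_iff:
  fixes s \<xi> :: "'p::prime_card padic"
  shows "\<xi> \<in> padic_wavelet_ball \<gamma> s \<longleftrightarrow> padic_norm (s + padic_p powi (- \<gamma>) * \<xi>) \<le> 1"
proof -
  have "s + padic_p powi (- \<gamma>) * \<xi> = padic_p powi (- \<gamma>) * (\<xi> + padic_p powi \<gamma> * s)"
    using padic_p_nonzero[where 'p='p] by (simp add: distrib_left power_int_minus flip: mult.assoc)
  then have "padic_norm (s + padic_p powi (- \<gamma>) * \<xi>) = real CARD('p) powi \<gamma> * padic_norm (\<xi> + padic_p powi \<gamma> * s)"
    by (simp add: padic_norm_mult padic_norm_p_powi)
  then show ?thesis
    using card_gt_1[where 'p='p]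
    by (simp add: padic_wavelet_ball_def padic_ball_def power_int_minus field_simps)
qed

text \<open>Since |s| = p^m > 1, a point of the ball has norm exactly p^(m - \<gamma>), which
  determines \<gamma>. Then \<open>s\<close> and \<open>s'\<close> are congruent modulo Z_p and both
  belong to \<open>padic_I\<close>.\<close>

lemma padic_wavelet_ball_unique:
  fixes s s' \<xi> :: "'p::prime_card padic"
  assumes m: "m \<ge> 1" and s: "s \<in> padic_J m" "s' \<in> padic_J m"
    and x: "\<xi> \<in> padic_wavelet_ball \<gamma> s" "\<xi> \<in> padic_wavelet_ball \<gamma>' s'"
  shows "\<gamma> = \<gamma>' \<and> s = s'"
proof -
  have p1: "real CARD('p) > 1" by (rule card_gt_1)
  have norm: "padic_norm \<xi> = real CARD('p) powi (int m - \<gamma>)"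
    if "s \<in> padic_J m" "\<xi> \<in> padic_wavelet_ball \<gamma> s" for \<gamma> and s :: "'p padic"
  proof -
    have n: "padic_norm (- s) = real CARD('p) powi (int m)" using padic_norm_J[OF m that(1)] by simp
    have "padic_norm (- s - padic_p powi (- \<gamma>) * \<xi>) \<le> 1"
      using that(2) padic_norm_minus[of "s + padic_p powi (- \<gamma>) * \<xi>"] by (simp add: padic_wavelet_ball_iff)
    also have "1 < padic_norm (- s)" unfolding n using p1 m by simp
    finally have "padic_norm (padic_p powi (- \<gamma>) * \<xi>) = real CARD('p) powi (int m)"
      using padic_norm_near n by metis
    then show ?thesis
      using p1 by (simp add: padic_norm_mult padic_norm_p_powi power_int_diff field_simps)
  qed
  have "real CARD('p) powi (int m - \<gamma>) = real CARD('p) powi (int m - \<gamma>')"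
    using norm s x by metis
  then have g: "\<gamma> = \<gamma>'"
    using card_powi_le_iff[of "int m - \<gamma>" "int m - \<gamma>'", where 'p='p]
      card_powi_le_iff[of "int m - \<gamma>'" "int m - \<gamma>", where 'p='p] by simp
  have "padic_norm (s - s') \<le> 1"
    using padic_norm_diff_le[of "s + padic_p powi (- \<gamma>) * \<xi>" 1 "s' + padic_p powi (- \<gamma>) * \<xi>"] x g
    by (simp add: padic_wavelet_ball_iff)
  then have "s = s'" using padic_I_unique padic_J_subset_I[OF m] s by blast
  with g show ?thesis ..
qed

lemma padic_wavelet_ball_covers:
  fixes \<xi> :: "'p::prime_card padic"
  assumes m: "m \<ge> 1" and "\<xi> \<noteq> 0"
  obtains \<gamma> s where "s \<in> padic_J m" "\<xi> \<in> padic_wavelet_ball \<gamma> s"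
proof -
  have p1: "real CARD('p) > 1" by (rule card_gt_1)
  obtain n where n: "padic_norm \<xi> = real CARD('p) powi n" using assms(2) by (rule padic_norm_cases)
  \<comment> \<open>The scale at which -p^(-\<gamma>) \<xi> has norm p^m, as the elements of
    \<open>padic_J m\<close> do; \<open>s\<close> is its representative there.\<close>
  define \<gamma> where "\<gamma> = int m - n"
  have "padic_norm (- (padic_p powi (- \<gamma>) * \<xi>)) = real CARD('p) powi (int m)"
    unfolding padic_norm_minus padic_norm_mult padic_norm_p_powi n \<gamma>_def
    using p1 by (simp add: power_int_diff)
  then obtain s where s: "s \<in> padic_J m" "padic_norm (- (padic_p powi (- \<gamma>) * \<xi>) - s) \<le> 1"
    using padic_J_exists[OF m] by blast
  then have "\<xi> \<in> padic_wavelet_ball \<gamma> s"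
    using padic_norm_minus_commute[of "- (padic_p powi (- \<gamma>) * \<xi>)" s]
    by (simp add: padic_wavelet_ball_iff)
  with s(1) show ?thesis by (rule that)
qed

section \<open>The transformed wavelets and their inner products\<close>

definition padic_wavelet :: "int \<Rightarrow> 'p::prime_card padic \<Rightarrow> 'p padic \<Rightarrow> 'p padic \<Rightarrow> complex" where
  "padic_wavelet \<gamma> s a \<xi> = of_real (real CARD('p) powr (real_of_int \<gamma> / 2)) *
     padic_char (padic_p powi (- \<gamma>) * a * \<xi>) * indicator (padic_wavelet_ball \<gamma> s) \<xi>"

lemma padic_wavelet_eq:
  fixes s a \<xi> :: "'p::prime_card padic"
  shows "padic_wavelet \<gamma> s a \<xi> = of_real (real CARD('p) powr (real_of_int \<gamma> / 2)) *
     padic_char (padic_p powi (- \<gamma>) * a * \<xi>) *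
     of_real (Omega (padic_norm (s + padic_p powi (- \<gamma>) * \<xi>)))"
  by (simp add: padic_wavelet_def padic_wavelet_ball_iff Omega_def indicator_def)

lemma padic_wavelet_borel [measurable]: "padic_wavelet \<gamma> s a \<in> borel_measurable borel"
  unfolding padic_wavelet_def padic_wavelet_ball_def by measurable

lemma card_powr_half_square:
  "real CARD('p::prime_card) powr (real_of_int \<gamma> / 2) * real CARD('p) powr (real_of_int \<gamma> / 2) = real CARD('p) powi \<gamma>"
  using card_gt_1[where 'p='p] by (simp add: powr_real_of_int' flip: powr_add)

lemma padic_wavelet_mult_cnj:
  fixes s a b \<xi> :: "'p::prime_card padic"
  shows "padic_wavelet \<gamma> s a \<xi> * cnj (padic_wavelet \<gamma> s b \<xi>)
    = of_real (real CARD('p) powi \<gamma>) *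
      (padic_char (padic_p powi (- \<gamma>) * (a - b) * \<xi>) * indicator (padic_wavelet_ball \<gamma> s) \<xi>)"
proof -
  have "padic_char (padic_p powi (- \<gamma>) * (a - b) * \<xi>)
      = padic_char (padic_p powi (- \<gamma>) * a * \<xi>) * cnj (padic_char (padic_p powi (- \<gamma>) * b * \<xi>))"
    by (simp add: right_diff_distrib left_diff_distrib padic_char_diff)
  then show ?thesis
    by (simp add: padic_wavelet_def indicator_def mult_ac flip: card_powr_half_square)
qed

context padic_haar
begin

text \<open>The characters of the transform and of the wavelet merge into one of frequency
  \<open>b\<close> on a ball of measure p^\<gamma>. The integral is nonzero iff |b| <=
  p^(-\<gamma>), i.e. iff \<xi> lies in the wavelet ball, and this measure turns the factor
  p^(-\<gamma>/2) into p^(\<gamma>/2).\<close>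

lemma fourier_theta:
  "padic_fourier M (padic_theta \<gamma> s a) \<xi> = padic_wavelet \<gamma> s a \<xi>"
proof -
  have p1: "real CARD('p) > 1" by (rule card_gt_1)
  define P :: "'p padic" where "P = padic_p powi \<gamma>"
  have P0: "P \<noteq> 0" using padic_p_nonzero by (simp add: P_def)
  have Pm: "padic_p powi (- \<gamma>) = inverse P" by (simp add: P_def power_int_minus)
  define b where "b = \<xi> + s * P"
  define q where "q = real CARD('p) powr (- real_of_int \<gamma> / 2)"
  have nP: "padic_norm P = real CARD('p) powi (- \<gamma>)" unfolding P_def by (rule padic_norm_p_powi)
  have ball: "padic_norm (P * x - a) \<le> 1 \<longleftrightarrow> x \<in> padic_ball (a / P) (- \<gamma>)" for x
  proof -
    have "P * x - a = P * (x - a / P)" using P0 by (simp add: field_simps)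
    then have "padic_norm (P * x - a) = real CARD('p) powi (- \<gamma>) * padic_norm (x - a / P)"
      by (simp add: padic_norm_mult nP)
    then show ?thesis by (simp add: padic_ball_def card_powi_mult_le_1_iff)
  qed
  have "padic_char (\<xi> * x) * padic_theta \<gamma> s a x
      = of_real q * cnj (padic_char (s * a)) * (padic_char (b * x) * indicator (padic_ball (a / P) (- \<gamma>)) x)" for x
  proof -
    have "padic_char (\<xi> * x) * padic_char (s * (P * x - a)) = padic_char (b * x) * cnj (padic_char (s * a))"
      unfolding b_def right_diff_distrib padic_char_diff distrib_right padic_char_add
      by (simp add: mult.assoc)
    then have "padic_char (\<xi> * x) * padic_theta \<gamma> s a x
      = of_real q * (padic_char (b * x) * cnj (padic_char (s * a))) * of_real (Omega (padic_norm (P * x - a)))"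
      unfolding padic_theta_def q_def[symmetric] P_def[symmetric] by (simp add: mult.left_commute)
    also have "of_real (Omega (padic_norm (P * x - a))) = (indicator (padic_ball (a / P) (- \<gamma>)) x :: complex)"
      by (simp add: Omega_def indicator_def flip: ball)
    finally show ?thesis by (simp add: mult_ac)
  qed
  then have "padic_fourier M (padic_theta \<gamma> s a) \<xi> = of_real q * cnj (padic_char (s * a)) *
      (LINT x|M. padic_char (b * x) * indicator (padic_ball (a / P) (- \<gamma>)) x)"
    unfolding padic_fourier_def by simp
  also have "\<dots> = of_real q * cnj (padic_char (s * a)) *
      (if padic_norm b \<le> real CARD('p) powi (- \<gamma>) then of_real (real CARD('p) powi \<gamma>) * padic_char (b * (a / P)) else 0)"
    unfolding integral_char_ball by simp
  also have "padic_norm b \<le> real CARD('p) powi (- \<gamma>) \<longleftrightarrow> \<xi> \<in> padic_wavelet_ball \<gamma> s"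
    by (simp add: b_def padic_wavelet_ball_def padic_ball_def P_def mult.commute)
  \<comment> \<open>Evaluation at the centre a / P produces the character value at s a, which
    cancels the conjugate factor split off above.\<close>
  also have "padic_char (b * (a / P)) = padic_char (inverse P * a * \<xi>) * padic_char (s * a)"
  proof -
    have "b * (a / P) = inverse P * a * \<xi> + s * a" using P0 by (simp add: b_def field_simps)
    then show ?thesis by (simp add: padic_char_add)
  qed
  also have "of_real q * cnj (padic_char (s * a)) * (if \<xi> \<in> padic_wavelet_ball \<gamma> s
      then of_real (real CARD('p) powi \<gamma>) * (padic_char (inverse P * a * \<xi>) * padic_char (s * a)) else 0)
     = of_real (q * real CARD('p) powi \<gamma>) * (cnj (padic_char (s * a)) * padic_char (s * a)) *
       padic_char (inverse P * a * \<xi>) * indicator (padic_wavelet_ball \<gamma> s) \<xi>"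
    by (simp add: mult_ac)
  also have "cnj (padic_char (s * a)) * padic_char (s * a) = 1"
    using complex_norm_square[of "padic_char (s * a)"] by (simp add: mult.commute)
  also have "q * real CARD('p) powi \<gamma> = real CARD('p) powr (real_of_int \<gamma> / 2)"
    using p1 by (simp add: q_def powr_minus flip: card_powr_half_square)
  finally show ?thesis by (simp add: padic_wavelet_def Pm)
qed

text \<open>Different pairs \<open>(\<gamma>, s)\<close> have disjoint supports. For equal pairs the
  product has frequency p^(-\<gamma>) (a - a'), of norm p^\<gamma> |a - a'|; its character is
  constant on the ball iff |a - a'| <= 1, that is iff a = a'.\<close>

lemma L2_inner_wavelet:
  assumes m: "m \<ge> 1" and s: "s \<in> padic_J m" "s' \<in> padic_J m" and a: "a \<in> padic_I" "a' \<in> padic_I"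
  shows "L2_inner M (padic_wavelet \<gamma> s a) (padic_wavelet \<gamma>' s' a')
    = (if (\<gamma>, s, a) = (\<gamma>', s', a') then 1 else 0)"
proof (cases "\<gamma> = \<gamma>' \<and> s = s'")
  case True
  have p1: "real CARD('p) > 1" by (rule card_gt_1)
  have "L2_inner M (padic_wavelet \<gamma> s a) (padic_wavelet \<gamma> s a')
      = of_real (real CARD('p) powi \<gamma>) *
        (if padic_norm (padic_p powi (- \<gamma>) * (a - a')) \<le> real CARD('p) powi \<gamma>
         then of_real (real CARD('p) powi (- \<gamma>)) *
              padic_char (padic_p powi (- \<gamma>) * (a - a') * - (padic_p powi \<gamma> * s)) else 0)"
    unfolding L2_inner_def padic_wavelet_mult_cnj padic_wavelet_ball_def integral_mult_right_zero integral_char_ball ..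
  also have "padic_norm (padic_p powi (- \<gamma>) * (a - a')) \<le> real CARD('p) powi \<gamma> \<longleftrightarrow> a = a'"
    using p1 padic_I_unique[OF a] by (auto simp: padic_norm_mult padic_norm_p_powi zero_le_power_int)
  finally show ?thesis using True p1 by (simp add: power_int_minus flip: of_real_mult)
next
  case False
  then have eq: "padic_wavelet \<gamma> s a \<xi> * cnj (padic_wavelet \<gamma>' s' a' \<xi>) = 0" for \<xi>
    using padic_wavelet_ball_unique[OF m s] by (auto simp: padic_wavelet_def indicator_def)
  show ?thesis using False unfolding L2_inner_def eq by auto
qed

lemma square_integrable_wavelet: "square_integrable M (padic_wavelet \<gamma> s a)"
proof -
  have "(cmod (padic_wavelet \<gamma> s a \<xi>))\<^sup>2 = real CARD('p) powi \<gamma> * indicator (padic_wavelet_ball \<gamma> s) \<xi>" for \<xi>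
    by (simp add: padic_wavelet_def indicator_def norm_mult power2_eq_square card_powr_half_square)
  moreover have "integrable M (\<lambda>\<xi>. indicator (padic_wavelet_ball \<gamma> s) \<xi> :: real)"
    unfolding padic_wavelet_ball_def by (intro integrable_real_indicator) (auto simp: emeasure_ball)
  ultimately show ?thesis unfolding square_integrable_def by simp
qed

end

section \<open>Completeness\<close>

text \<open>\<open>L2_sq\<close> replaces \<open>L2_norm\<close> so that only the crude inequality
  \<open>|a + b|\<^sup>2 \<le> 2|a|\<^sup>2 + 2|b|\<^sup>2\<close> is needed in place of Minkowski's.\<close>

definition L2_sq :: "'a measure \<Rightarrow> ('a \<Rightarrow> complex) \<Rightarrow> real" where
  "L2_sq M f = (LINT x|M. (cmod (f x))\<^sup>2)"

lemma cmod_add_square_le: "(cmod (a + b))\<^sup>2 \<le> 2 * (cmod a)\<^sup>2 + 2 * (cmod b)\<^sup>2"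
proof -
  have "(cmod (a + b))\<^sup>2 \<le> (cmod a + cmod b)\<^sup>2"
    by (intro power_mono norm_triangle_ineq) simp
  also have "\<dots> \<le> 2 * (cmod a)\<^sup>2 + 2 * (cmod b)\<^sup>2"
    using zero_le_power2[of "cmod a - cmod b"] by (simp add: power2_eq_square algebra_simps)
  finally show ?thesis .
qed

lemma square_integrable_bound:
  assumes "square_integrable M f" "g \<in> borel_measurable M"
    and "AE x in M. cmod (g x) \<le> K * cmod (f x)"
  shows "square_integrable M g"
proof -
  have "integrable M (\<lambda>x. (cmod (g x))\<^sup>2)"
  proof (rule Bochner_Integration.integrable_bound)
    show "integrable M (\<lambda>x. K\<^sup>2 * (cmod (f x))\<^sup>2)"
      using assms(1) by (simp add: square_integrable_def)
    show "(\<lambda>x. (cmod (g x))\<^sup>2) \<in> borel_measurable M" using assms(2) by measurable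
    show "AE x in M. norm ((cmod (g x))\<^sup>2) \<le> norm (K\<^sup>2 * (cmod (f x))\<^sup>2)"
      using assms(3)
    proof eventually_elim
      case (elim x)
      then have "(cmod (g x))\<^sup>2 \<le> (K * cmod (f x))\<^sup>2" by (intro power_mono) auto
      then show ?case by (simp add: power_mult_distrib)
    qed
  qed
  with assms(2) show ?thesis by (simp add: square_integrable_def)
qed

lemma square_integrable_scale:
  assumes "square_integrable M f"
  shows "square_integrable M (\<lambda>x. c * f x)"
  using assms by (intro square_integrable_bound[OF assms, of _ "cmod c"])
    (auto simp: square_integrable_def norm_mult)

lemma square_integrable_add:
  assumes "square_integrable M f" "square_integrable M g"
  shows "square_integrable M (\<lambda>x. f x + g x)"
    and "L2_sq M (\<lambda>x. f x + g x) \<le> 2 * L2_sq M f + 2 * L2_sq M g"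
proof -
  have m [measurable]: "f \<in> borel_measurable M" "g \<in> borel_measurable M"
    using assms by (simp_all add: square_integrable_def)
  have i: "integrable M (\<lambda>x. (cmod (f x))\<^sup>2)" "integrable M (\<lambda>x. (cmod (g x))\<^sup>2)"
    using assms by (simp_all add: square_integrable_def)
  then have i2: "integrable M (\<lambda>x. 2 * (cmod (f x))\<^sup>2 + 2 * (cmod (g x))\<^sup>2)" by simp
  have i3: "integrable M (\<lambda>x. (cmod (f x + g x))\<^sup>2)"
    by (rule Bochner_Integration.integrable_bound[OF i2]) (auto simp: cmod_add_square_le)
  then show "square_integrable M (\<lambda>x. f x + g x)" by (simp add: square_integrable_def)
  have "L2_sq M (\<lambda>x. f x + g x) \<le> (LINT x|M. 2 * (cmod (f x))\<^sup>2 + 2 * (cmod (g x))\<^sup>2)"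
    unfolding L2_sq_def by (rule integral_mono[OF i3 i2]) (rule cmod_add_square_le)
  then show "L2_sq M (\<lambda>x. f x + g x) \<le> 2 * L2_sq M f + 2 * L2_sq M g"
    using i by (simp add: L2_sq_def)
qed

lemma square_integrable_diff:
  assumes "square_integrable M f" "square_integrable M g"
  shows "square_integrable M (\<lambda>x. f x - g x)"
  using square_integrable_add(1)[OF assms(1) square_integrable_scale[OF assms(2), of "-1"]] by simp

section \<open>Linear span and its closure in L2\<close>

definition lin_span :: "'i set \<Rightarrow> ('i \<Rightarrow> 'a \<Rightarrow> complex) \<Rightarrow> ('a \<Rightarrow> complex) set" where
  "lin_span I e = {\<lambda>x. \<Sum>i\<in>F. c i * e i x |F c. finite F \<and> F \<subseteq> I}"

text \<open>Closure as approximability from the algebraic span; membership of every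
  square-integrable function is then the completeness clause, up to squaring the distance.\<close>

definition L2_closed_span :: "'a measure \<Rightarrow> 'i set \<Rightarrow> ('i \<Rightarrow> 'a \<Rightarrow> complex) \<Rightarrow> ('a \<Rightarrow> complex) set" where
  "L2_closed_span M I e = {f. square_integrable M f \<and>
     (\<forall>\<epsilon>>0. \<exists>h\<in>lin_span I e. L2_sq M (\<lambda>x. f x - h x) < \<epsilon>)}"

lemma lin_span_zero: "(\<lambda>x. 0) \<in> lin_span I e"
  unfolding lin_span_def by (intro CollectI exI[of _ "{}"]) auto

lemma lin_span_basis:
  assumes "i \<in> I"
  shows "e i \<in> lin_span I e"
  unfolding lin_span_def using assms
  by (intro CollectI exI[of _ "{i}"] exI[of _ "\<lambda>_. 1"]) auto

lemma lin_span_scale: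
  assumes "h \<in> lin_span I e"
  shows "(\<lambda>x. b * h x) \<in> lin_span I e"
proof -
  obtain F c where "h = (\<lambda>x. \<Sum>i\<in>F. c i * e i x)" "finite F" "F \<subseteq> I"
    using assms unfolding lin_span_def by blast
  then show ?thesis unfolding lin_span_def
    by (intro CollectI exI[of _ F] exI[of _ "\<lambda>i. b * c i"]) (auto simp: sum_distrib_left mult.assoc)
qed

lemma lin_span_add:
  assumes "g \<in> lin_span I e" "h \<in> lin_span I e"
  shows "(\<lambda>x. g x + h x) \<in> lin_span I e"
proof -
  obtain F c where F: "g = (\<lambda>x. \<Sum>i\<in>F. c i * e i x)" "finite F" "F \<subseteq> I"
    using assms(1) unfolding lin_span_def by blast
  obtain G d where G: "h = (\<lambda>x. \<Sum>i\<in>G. d i * e i x)" "finite G" "G \<subseteq> I"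
    using assms(2) unfolding lin_span_def by blast
  define b where "b i = (if i \<in> F then c i else 0) + (if i \<in> G then d i else 0)" for i
  have "g x + h x = (\<Sum>i\<in>F \<union> G. b i * e i x)" for x
  proof -
    have "g x = (\<Sum>i\<in>F \<union> G. (if i \<in> F then c i else 0) * e i x)"
      unfolding F(1) using F(2) G(2) by (intro sum.mono_neutral_cong_left) auto
    moreover have "h x = (\<Sum>i\<in>F \<union> G. (if i \<in> G then d i else 0) * e i x)"
      unfolding G(1) using F(2) G(2) by (intro sum.mono_neutral_cong_left) auto
    ultimately show ?thesis by (simp add: b_def distrib_right sum.distrib)
  qed
  then show ?thesis unfolding lin_span_def
    using F(2,3) G(2,3) by (intro CollectI exI[of _ "F \<union> G"] exI[of _ b]) auto
qed

lemma lin_span_sum: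
  assumes "finite A" "\<And>j. j \<in> A \<Longrightarrow> f j \<in> lin_span I e"
  shows "(\<lambda>x. \<Sum>j\<in>A. f j x) \<in> lin_span I e"
  using assms
proof (induction A rule: finite_induct)
  case empty
  then show ?case by (simp add: lin_span_zero)
next
  case (insert j A)
  then show ?case by (simp add: lin_span_add)
qed

context
  fixes M :: "'a measure" and I :: "'i set" and e :: "'i \<Rightarrow> 'a \<Rightarrow> complex"
  assumes sq: "\<And>i. i \<in> I \<Longrightarrow> square_integrable M (e i)"
begin

lemma square_integrable_lin_span:
  assumes "h \<in> lin_span I e"
  shows "square_integrable M h"
proof -
  obtain F c where F: "h = (\<lambda>x. \<Sum>i\<in>F. c i * e i x)" "finite F" "F \<subseteq> I"
    using assms unfolding lin_span_def by blast
  have "square_integrable M (\<lambda>x. \<Sum>i\<in>F. c i * e i x)"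
    using F(2,3)
  proof (induction F rule: finite_induct)
    case empty
    then show ?case by (simp add: square_integrable_def)
  next
    case (insert i F)
    then show ?case by (simp add: square_integrable_add square_integrable_scale sq)
  qed
  then show ?thesis by (simp add: F(1))
qed

lemma lin_span_subset_closed: "h \<in> lin_span I e \<Longrightarrow> h \<in> L2_closed_span M I e"
  unfolding L2_closed_span_def using square_integrable_lin_span
  by (auto intro!: bexI[of _ h] simp: L2_sq_def)

text \<open>The closure is closed: approximate by one of its elements, then that element by the
  span. Sums, multiples and dominated limits are reduced to this.\<close>

lemma L2_closed_span_limit:
  assumes f: "square_integrable M f"
    and ex: "\<And>\<epsilon>. \<epsilon> > 0 \<Longrightarrow> \<exists>g\<in>L2_closed_span M I e. L2_sq M (\<lambda>x. f x - g x) < \<epsilon>"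
  shows "f \<in> L2_closed_span M I e"
  unfolding L2_closed_span_def
proof (intro CollectI conjI f allI impI)
  fix \<epsilon> :: real assume "\<epsilon> > 0"
  \<comment> \<open>The crude inequality doubles each of the two errors, hence
    \<open>\<epsilon> / 4\<close>.\<close>
  then obtain g where g: "g \<in> L2_closed_span M I e" "L2_sq M (\<lambda>x. f x - g x) < \<epsilon> / 4"
    using ex[of "\<epsilon> / 4"] by auto
  then obtain h where h: "h \<in> lin_span I e" "L2_sq M (\<lambda>x. g x - h x) < \<epsilon> / 4"
    using \<open>\<epsilon> > 0\<close> unfolding L2_closed_span_def by (auto dest!: spec[of _ "\<epsilon> / 4"])
  have sg: "square_integrable M g" using g(1) by (simp add: L2_closed_span_def)
  have "L2_sq M (\<lambda>x. (f x - g x) + (g x - h x))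
     \<le> 2 * L2_sq M (\<lambda>x. f x - g x) + 2 * L2_sq M (\<lambda>x. g x - h x)"
    by (intro square_integrable_add(2) square_integrable_diff f sg square_integrable_lin_span h)
  also have "\<dots> < \<epsilon>" using g(2) h(2) by simp
  finally show "\<exists>h\<in>lin_span I e. L2_sq M (\<lambda>x. f x - h x) < \<epsilon>"
    using h(1) by auto
qed

lemma L2_closed_span_add:
  assumes f: "f \<in> L2_closed_span M I e" and g: "g \<in> L2_closed_span M I e"
  shows "(\<lambda>x. f x + g x) \<in> L2_closed_span M I e"
proof (rule L2_closed_span_limit)
  have sf: "square_integrable M f" and sg: "square_integrable M g"
    using f g by (simp_all add: L2_closed_span_def)
  then show "square_integrable M (\<lambda>x. f x + g x)" by (rule square_integrable_add)
  fix \<epsilon> :: real assume "\<epsilon> > 0"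
  obtain h where h: "h \<in> lin_span I e" "L2_sq M (\<lambda>x. f x - h x) < \<epsilon> / 4"
    using \<open>\<epsilon> > 0\<close> f unfolding L2_closed_span_def by (auto dest!: spec[of _ "\<epsilon> / 4"])
  obtain k where k: "k \<in> lin_span I e" "L2_sq M (\<lambda>x. g x - k x) < \<epsilon> / 4"
    using \<open>\<epsilon> > 0\<close> g unfolding L2_closed_span_def by (auto dest!: spec[of _ "\<epsilon> / 4"])
  have "L2_sq M (\<lambda>x. (f x - h x) + (g x - k x))
     \<le> 2 * L2_sq M (\<lambda>x. f x - h x) + 2 * L2_sq M (\<lambda>x. g x - k x)"
    by (intro square_integrable_add(2) square_integrable_diff sf sg square_integrable_lin_span h k)
  also have "\<dots> < \<epsilon>" using h(2) k(2) by simp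
  finally have "L2_sq M (\<lambda>x. f x + g x - (h x + k x)) < \<epsilon>" by (simp add: algebra_simps)
  then show "\<exists>h\<in>L2_closed_span M I e. L2_sq M (\<lambda>x. f x + g x - h x) < \<epsilon>"
    by (intro bexI[of _ "\<lambda>x. h x + k x"] lin_span_subset_closed lin_span_add h k)
qed

lemma L2_closed_span_scale:
  assumes f: "f \<in> L2_closed_span M I e"
  shows "(\<lambda>x. c * f x) \<in> L2_closed_span M I e"
proof (rule L2_closed_span_limit)
  have sf: "square_integrable M f" using f by (simp add: L2_closed_span_def)
  then show "square_integrable M (\<lambda>x. c * f x)" by (rule square_integrable_scale)
  fix \<epsilon> :: real assume "\<epsilon> > 0"
  \<comment> \<open>The summand 1 avoids dividing by 0 when \<open>c = 0\<close>.\<close>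
  have pos: "(cmod c)\<^sup>2 + 1 > 0" by (simp add: add_nonneg_pos)
  then have "\<epsilon> / ((cmod c)\<^sup>2 + 1) > 0" using \<open>\<epsilon> > 0\<close> by simp
  then obtain h where h: "h \<in> lin_span I e" "L2_sq M (\<lambda>x. f x - h x) < \<epsilon> / ((cmod c)\<^sup>2 + 1)"
    using f unfolding L2_closed_span_def by blast
  have "L2_sq M (\<lambda>x. c * f x - c * h x) = (cmod c)\<^sup>2 * L2_sq M (\<lambda>x. f x - h x)"
    by (simp add: L2_sq_def norm_mult power_mult_distrib flip: right_diff_distrib)
  also have "\<dots> \<le> ((cmod c)\<^sup>2 + 1) * L2_sq M (\<lambda>x. f x - h x)"
    by (intro mult_right_mono) (auto simp: L2_sq_def)
  also have "\<dots> < \<epsilon>" using h(2) pos by (simp add: field_simps)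
  finally have "L2_sq M (\<lambda>x. c * f x - c * h x) < \<epsilon>" .
  then show "\<exists>h\<in>L2_closed_span M I e. L2_sq M (\<lambda>x. c * f x - h x) < \<epsilon>"
    by (intro bexI[of _ "\<lambda>x. c * h x"] lin_span_subset_closed lin_span_scale h)
qed

lemma L2_closed_span_sum:
  assumes "finite A" "\<And>j. j \<in> A \<Longrightarrow> f j \<in> L2_closed_span M I e"
  shows "(\<lambda>x. \<Sum>j\<in>A. f j x) \<in> L2_closed_span M I e"
  using assms
proof (induction A rule: finite_induct)
  case empty
  then show ?case by (simp add: lin_span_subset_closed lin_span_zero)
next
  case (insert j A)
  then show ?case by (simp add: L2_closed_span_add)
qed

text \<open>Domination by a multiple of |f| itself makes (1 + K)^2 |f|^2 an integrable majorant of
  the squared error. The form fits both uses: partial sums of disjoint indicators with K = 1, simple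
  functions with K = 2.\<close>

lemma L2_closed_span_dominated:
  assumes f: "square_integrable M f" and g: "\<And>n. g n \<in> L2_closed_span M I e"
    and lim: "AE x in M. (\<lambda>n. g n x) \<longlonglongrightarrow> f x"
    and bound: "\<And>n. AE x in M. cmod (g n x) \<le> K * cmod (f x)"
  shows "f \<in> L2_closed_span M I e"
proof (rule L2_closed_span_limit[OF f])
  have [measurable]: "f \<in> borel_measurable M" "\<And>n. g n \<in> borel_measurable M"
    using f g by (simp_all add: square_integrable_def L2_closed_span_def)
  have "(\<lambda>n. L2_sq M (\<lambda>x. f x - g n x)) \<longlonglongrightarrow> (LINT x|M. 0)"
    unfolding L2_sq_def
  proof (rule integral_dominated_convergence)
    show "integrable M (\<lambda>x. (1 + K)\<^sup>2 * (cmod (f x))\<^sup>2)"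
      using f by (simp add: square_integrable_def)
    show "AE x in M. (\<lambda>n. (cmod (f x - g n x))\<^sup>2) \<longlonglongrightarrow> 0"
      using lim
    proof eventually_elim
      case (elim x)
      have "(\<lambda>n. (cmod (f x - g n x))\<^sup>2) \<longlonglongrightarrow> (cmod (f x - f x))\<^sup>2"
        by (intro tendsto_intros elim)
      then show ?case by simp
    qed
    show "AE x in M. norm ((cmod (f x - g n x))\<^sup>2) \<le> (1 + K)\<^sup>2 * (cmod (f x))\<^sup>2" for n
      using bound[of n]
    proof eventually_elim
      case (elim x)
      then have "cmod (f x - g n x) \<le> (1 + K) * cmod (f x)"
        using norm_triangle_ineq4[of "f x" "g n x"] by (simp add: distrib_right)
      then have "(cmod (f x - g n x))\<^sup>2 \<le> ((1 + K) * cmod (f x))\<^sup>2" by (intro power_mono) auto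
      then show ?case by (simp add: power_mult_distrib)
    qed
  qed measurable
  then have L: "(\<lambda>n. L2_sq M (\<lambda>x. f x - g n x)) \<longlonglongrightarrow> 0" by simp
  fix \<epsilon> :: real assume "\<epsilon> > 0"
  then obtain n where "L2_sq M (\<lambda>x. f x - g n x) < \<epsilon>"
    using order_tendstoD(2)[OF L] by (auto simp: eventually_sequentially)
  then show "\<exists>h\<in>L2_closed_span M I e. L2_sq M (\<lambda>x. f x - h x) < \<epsilon>"
    using g by blast
qed

end

section \<open>Root-of-unity sums and balls as generators of the Borel sets\<close>

lemma sum_roots_of_unity:
  fixes z :: complex
  assumes "z ^ n = 1"
  shows "(\<Sum>j<n. z ^ j) = (if z = 1 then of_nat n else 0)"
  using assms by (simp add: geometric_sum)

text \<open>The empty set is included for closure under intersection, since two balls are nested or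
  disjoint.\<close>

definition padic_balls :: "'p::prime_card padic set set" where
  "padic_balls = insert {} (range (\<lambda>(c, n). padic_ball c n))"

lemma Int_stable_padic_balls: "Int_stable (padic_balls :: 'p::prime_card padic set set)"
proof (rule Int_stableI)
  have *: "padic_ball c k \<inter> padic_ball d n \<in> padic_balls" if "n \<le> k" for c d :: "'p padic" and k n
    using padic_ball_nested[OF that, of c d] by (auto simp: padic_balls_def Int_absorb2)
  fix A B :: "'p padic set" assume "A \<in> padic_balls" "B \<in> padic_balls"
  then consider "A = {} \<or> B = {}" | c k d n where "A = padic_ball c k" "B = padic_ball d n"
    unfolding padic_balls_def by auto
  then show "A \<inter> B \<in> padic_balls"
  proof cases
    case 1
    then show ?thesis by (auto simp: padic_balls_def)
  next
    case 2
    then show ?thesis using *[of n k c d] *[of k n d c] by (cases "n \<le> k") (auto simp: Int_commute)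
  qed
qed

text \<open>Any point of a ball is a centre of it, so rational centres suffice; with integer indices
  only countably many balls occur, and an open set is the union of those it contains.\<close>

lemma borel_subset_sigma_balls:
  fixes A :: "'p::prime_card padic set"
  assumes "A \<in> sets borel"
  shows "A \<in> sigma_sets UNIV padic_balls"
proof -
  have op: "U \<in> sigma_sets UNIV padic_balls" if U: "open U" for U :: "'p padic set"
  proof -
    define B where "B = {V \<in> range (\<lambda>(q, n). padic_ball (of_rat q :: 'p padic) n). V \<subseteq> U}"
    have "U = \<Union>B"
    proof (intro Set.set_eqI iffI)
      fix x assume "x \<in> U"
      then obtain n where n: "padic_ball x n \<subseteq> U" using padic_ball_subset_open[OF U] by blast
      obtain q where "padic_norm (x - of_rat q) < real CARD('p) powi (- n)"
        using of_rat_dense[of "real CARD('p) powi (- n)" x] by auto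
      then have "x \<in> padic_ball (of_rat q) n" by (simp add: padic_ball_def)
      moreover from padic_ball_eq[OF this] n have "padic_ball (of_rat q) n \<in> B"
        by (auto simp: B_def)
      ultimately show "x \<in> \<Union>B" by blast
    qed (auto simp: B_def)
    moreover have "countable B" unfolding B_def by (rule countable_subset[of _ "range (\<lambda>(q, n). padic_ball (of_rat q :: 'p padic) n)"]) auto
    moreover have "B \<subseteq> padic_balls" by (auto simp: B_def padic_balls_def)
    ultimately show ?thesis
      by (metis (no_types, lifting) sigma_sets.Basic sigma_sets_UNION subsetD)
  qed
  have "A \<in> sigma_sets UNIV {S. open S}" using assms by (simp add: borel_def)
  moreover have "sigma_sets UNIV {S. open S} \<subseteq> sigma_sets UNIV (padic_balls :: 'p padic set set)"
    using op by (intro sigma_sets_mono) auto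
  ultimately show ?thesis by blast
qed

section \<open>Density of the span of the wavelets\<close>

context padic_haar
begin

abbreviation (input) "wavelet_index m \<equiv> UNIV \<times> padic_J m \<times> padic_I"

abbreviation (input) "wavelet_family \<equiv> \<lambda>(\<gamma>, s, a). padic_wavelet \<gamma> s a"

lemma square_integrable_family: "square_integrable M (wavelet_family i)"
  by (cases i) (simp add: square_integrable_wavelet)

text \<open>Finite Fourier inversion on the cyclic group of order \<open>p\<^sup>k\<close>.\<close>

lemma indicator_subball:
  fixes c :: "'p padic"
  assumes c: "c \<in> padic_wavelet_ball \<gamma> s"
  shows "indicator (padic_ball c (\<gamma> + int k)) \<xi> = (\<Sum>j<CARD('p) ^ k.
     of_real (real CARD('p) powr (- real_of_int \<gamma> / 2) / real CARD('p) ^ k) *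
     cnj (padic_char (padic_p powi (- \<gamma>) * (of_nat j / padic_p ^ k) * c)) *
     padic_wavelet \<gamma> s (of_nat j / padic_p ^ k) \<xi>)" (is "_ = (\<Sum>j<_. ?t j)")
proof (cases "\<xi> \<in> padic_wavelet_ball \<gamma> s")
  case False
  have "padic_ball c (\<gamma> + int k) \<subseteq> padic_wavelet_ball \<gamma> s"
    using padic_ball_mono[of \<gamma> "\<gamma> + int k" c] padic_ball_eq[OF c[unfolded padic_wavelet_ball_def]]
    by (simp add: padic_wavelet_ball_def)
  then show ?thesis using False by (auto simp: padic_wavelet_def indicator_def)
next
  case True
  have p1: "real CARD('p) > 1" by (rule card_gt_1)
  \<comment> \<open>The offset from \<open>c\<close>, rescaled to lie in Z_p. The j-th summand
    becomes a multiple of the j-th power of \<open>z\<close>, a p^k-th root of unity that equals 1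
    iff \<open>y\<close> lies in p^k Z_p, i.e. iff \<xi> lies in the small ball.\<close>
  define y where "y = padic_p powi (- \<gamma>) * (\<xi> - c)"
  define z where "z = padic_char (y / padic_p ^ k)"
  have ny: "padic_norm y = real CARD('p) powi \<gamma> * padic_norm (\<xi> - c)"
    by (simp add: y_def padic_norm_mult padic_norm_p_powi)
  have "\<xi> \<in> padic_ball c \<gamma>"
    using True padic_ball_eq[OF c[unfolded padic_wavelet_ball_def]] by (simp add: padic_wavelet_ball_def)
  then have y1: "padic_norm y \<le> 1"
    using p1 by (simp add: ny padic_ball_def power_int_minus field_simps)
  have zpow: "padic_char (padic_p powi (- \<gamma>) * (of_nat j / padic_p ^ k) * \<xi>)
      * cnj (padic_char (padic_p powi (- \<gamma>) * (of_nat j / padic_p ^ k) * c)) = z ^ j" for j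
  proof -
    have "padic_p powi (- \<gamma>) * (of_nat j / padic_p ^ k) * \<xi> - padic_p powi (- \<gamma>) * (of_nat j / padic_p ^ k) * c
      = of_nat j * (y / padic_p ^ k)"
      by (simp add: y_def field_simps)
    then show ?thesis by (simp add: z_def flip: padic_char_diff padic_char_of_nat_mult)
  qed
  have "z ^ (CARD('p) ^ k) = padic_char y"
    using padic_p_nonzero[where 'p='p] by (simp add: z_def flip: padic_char_of_nat_mult)
  also have "\<dots> = 1" using y1 by (simp add: padic_char_eq_1_iff)
  finally have z1: "z ^ (CARD('p) ^ k) = 1" .
  have "padic_norm (y / padic_p ^ k) \<le> 1 \<longleftrightarrow> \<xi> \<in> padic_ball c (\<gamma> + int k)"
    using p1 by (simp add: padic_norm_div_p_power ny padic_ball_def power_int_minus power_int_add power_int_diff field_simps)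
  then have zi: "z = 1 \<longleftrightarrow> \<xi> \<in> padic_ball c (\<gamma> + int k)" by (simp add: z_def padic_char_eq_1_iff)
  \<comment> \<open>The factor p^(-\<gamma>/2) removes the normalization of the wavelet, leaving the
    average of the powers of \<open>z\<close>.\<close>
  have "?t j = of_real (1 / real CARD('p) ^ k) * z ^ j" for j
    unfolding zpow[symmetric] using True p1
    by (simp add: padic_wavelet_def powr_minus field_simps)
  then have "(\<Sum>j<CARD('p) ^ k. ?t j) = of_real (1 / real CARD('p) ^ k) * (\<Sum>j<CARD('p) ^ k. z ^ j)"
    by (simp add: sum_distrib_left)
  also have "\<dots> = indicator (padic_ball c (\<gamma> + int k)) \<xi>"
    unfolding sum_roots_of_unity[OF z1] using p1 zi by (simp add: indicator_def)
  finally show ?thesis ..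
qed

context
  fixes m :: nat
  assumes m: "m \<ge> 1"
begin

abbreviation (input) "wavelet_closure \<equiv> L2_closed_span M (wavelet_index m) wavelet_family"

text \<open>The fractions j / p^k with j < p^k all belong to \<open>padic_I\<close>, so the
  inversion formula is a finite combination of family members.\<close>

lemma indicator_subball_closure:
  assumes s: "s \<in> padic_J m" and "c \<in> padic_wavelet_ball \<gamma> s"
  shows "(\<lambda>\<xi>. indicator (padic_ball c (\<gamma> + int k)) \<xi>) \<in> wavelet_closure"
  unfolding indicator_subball[OF assms(2)]
proof (intro lin_span_subset_closed square_integrable_family lin_span_sum lin_span_scale finite_lessThan)
  fix j assume "j \<in> {..<CARD('p) ^ k}"
  then have "of_nat j / padic_p ^ k \<in> (padic_I :: 'p padic set)" unfolding padic_I_eq by auto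
  then show "padic_wavelet \<gamma> s (of_nat j / padic_p ^ k) \<in> lin_span (wavelet_index m) wavelet_family"
    using lin_span_basis[of "(\<gamma>, s, of_nat j / padic_p ^ k)" "wavelet_index m" wavelet_family] s by simp
qed

lemma indicator_wavelet_ball_closure:
  assumes s: "s \<in> padic_J m"
  shows "(\<lambda>\<xi>. indicator (padic_wavelet_ball \<gamma> s) \<xi>) \<in> wavelet_closure"
  using indicator_subball_closure[OF s, of "- (padic_p powi \<gamma> * s)" \<gamma> 0]
  by (simp add: padic_wavelet_ball_def)

text \<open>Intersecting with one wavelet ball keeps complements at finite measure, so the
  \<pi>-\<lambda> induction stays inside L2, with the ball in the role of the whole space.\<close>

lemma indicator_closure:
  fixes A :: "'p padic set"
  assumes s: "s \<in> padic_J m" and A: "A \<in> sets borel"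
  shows "(\<lambda>\<xi>. indicator (A \<inter> padic_wavelet_ball \<gamma> s) \<xi>) \<in> wavelet_closure"
  \<comment> \<open>The middle fact supplies the inclusion of \<open>padic_balls\<close> in
    \<open>Pow UNIV\<close> that the induction rule demands.\<close>
  using Int_stable_padic_balls Pow_UNIV[THEN equalityD2, THEN subset_trans[OF subset_UNIV]] borel_subset_sigma_balls[OF A]
proof (induction rule: sigma_sets_induct_disjoint)
  case (basic B)
  let ?c = "- (padic_p powi \<gamma> * s)"
  \<comment> \<open>A nonempty \<open>B\<close> misses the wavelet ball, contains it or lies in it.
    In the last case \<gamma> <= n lets n be written as \<gamma> + k.\<close>
  consider "B \<inter> padic_wavelet_ball \<gamma> s = {}" | "B \<inter> padic_wavelet_ball \<gamma> s = padic_wavelet_ball \<gamma> s"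
    | c n where "B = padic_ball c n" "B \<subseteq> padic_wavelet_ball \<gamma> s" "\<gamma> \<le> n"
  proof -
    consider "B = {}" | c n where "B = padic_ball c n" using basic unfolding padic_balls_def by auto
    then show ?thesis
    proof cases
      case 2
      show ?thesis
      proof (cases "\<gamma> \<le> n")
        case True
        then show ?thesis using padic_ball_nested[OF True, of c ?c] 2 that
          unfolding padic_wavelet_ball_def by blast
      next
        case False
        then have "n \<le> \<gamma>" by simp
        from padic_ball_nested[OF this, of ?c c] show ?thesis using 2 that
          unfolding padic_wavelet_ball_def by blast
      qed
    qed (use that in auto)
  qed
  then show ?case
  proof cases
    case 1
    then show ?thesis by (simp add: lin_span_subset_closed square_integrable_family lin_span_zero)
  next
    case 2
    then show ?thesis by (simp add: indicator_wavelet_ball_closure s)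
  next
    case (3 c n)
    then have "c \<in> padic_wavelet_ball \<gamma> s" using padic_ball_center by blast
    from indicator_subball_closure[OF s this, of "nat (n - \<gamma>)"] 3 show ?thesis
      by (simp add: Int_absorb2)
  qed
next
  case empty
  then show ?case by (simp add: lin_span_subset_closed square_integrable_family lin_span_zero)
next
  case (compl B)
  have "(\<lambda>\<xi>. indicator (padic_wavelet_ball \<gamma> s) \<xi> + (- 1) * indicator (B \<inter> padic_wavelet_ball \<gamma> s) \<xi>) \<in> wavelet_closure"
    by (intro L2_closed_span_add L2_closed_span_scale square_integrable_family
        indicator_wavelet_ball_closure s compl)
  moreover have "indicator (padic_wavelet_ball \<gamma> s) \<xi> + (- 1) * indicator (B \<inter> padic_wavelet_ball \<gamma> s) \<xi>
     = (indicator ((UNIV - B) \<inter> padic_wavelet_ball \<gamma> s) \<xi> :: complex)" for \<xi>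
    by (simp add: indicator_def)
  ultimately show ?case by simp
next
  case (union B)
  let ?W = "padic_wavelet_ball \<gamma> s"
  have disj: "disjoint_family (\<lambda>i. B i \<inter> ?W)"
    using union(1) by (auto simp: disjoint_family_on_def)
  \<comment> \<open>Measurability of the pieces comes from the induction hypothesis and passes to
    the union as a pointwise limit.\<close>
  have meas: "(\<lambda>\<xi>. indicator (B i \<inter> ?W) \<xi> :: complex) \<in> borel_measurable M" for i
    using union(3)[of i] by (simp add: L2_closed_span_def square_integrable_def)
  \<comment> \<open>Partial sums are indicators of partial unions, hence bounded by the limit; this
    gives K = 1.\<close>
  have eq: "(\<Sum>i<n. indicator (B i \<inter> ?W) \<xi>) = (indicator (\<Union>i<n. B i \<inter> ?W) \<xi> :: complex)" for n \<xi>
    by (rule indicator_UN_disjoint[symmetric]) (auto intro: disjoint_family_on_mono[OF _ disj])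
  have U: "\<Union> (range B) \<inter> ?W = (\<Union>i. B i \<inter> ?W)" by auto
  have lim: "(\<lambda>n. \<Sum>i<n. indicator (B i \<inter> ?W) \<xi>) \<longlonglongrightarrow> (indicator (\<Union> (range B) \<inter> ?W) \<xi> :: complex)" for \<xi>
    unfolding eq U by (rule LIMSEQ_indicator_UN)
  show ?case
  proof (rule L2_closed_span_dominated[OF square_integrable_family, where K = 1])
    show "(\<lambda>\<xi>. \<Sum>i<n. indicator (B i \<inter> ?W) \<xi>) \<in> wavelet_closure" for n
      by (intro L2_closed_span_sum square_integrable_family union) auto
    show "AE x in M. (\<lambda>n. \<Sum>i<n. indicator (B i \<inter> ?W) x) \<longlonglongrightarrow> (indicator (\<Union> (range B) \<inter> ?W) x :: complex)"
      using lim by simp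
    show "AE x in M. cmod (\<Sum>i<n. indicator (B i \<inter> ?W) x) \<le> 1 * cmod (indicator (\<Union> (range B) \<inter> ?W) x)" for n
      unfolding eq by (auto simp: indicator_def)
    have "square_integrable M (\<lambda>\<xi>. indicator ?W \<xi>)"
      using indicator_wavelet_ball_closure[OF s] by (simp add: L2_closed_span_def)
    then show "square_integrable M (\<lambda>\<xi>. indicator (\<Union> (range B) \<inter> ?W) \<xi>)"
    proof (rule square_integrable_bound[where K = 1])
      show "(\<lambda>\<xi>. indicator (\<Union> (range B) \<inter> ?W) \<xi> :: complex) \<in> borel_measurable M"
        by (rule borel_measurable_LIMSEQ_metric[OF _ lim]) (intro borel_measurable_sum meas)
    qed (auto simp: indicator_def)
  qed
qed

text \<open>Two approximations run along the same \<open>n\<close>: simple functions tending to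
  \<open>f\<close>, and truncation to finitely many wavelet balls. Each approximant is then a finite
  combination of indicators covered by \<open>indicator_closure\<close>.\<close>

lemma wavelet_closure_complete:
  assumes f: "square_integrable M f"
  shows "f \<in> wavelet_closure"
proof -
  have fm: "f \<in> borel_measurable M" using f by (simp add: square_integrable_def)
  obtain S where S: "\<And>i. simple_function M (S i)" "\<And>x. (\<lambda>i. S i x) \<longlonglongrightarrow> f x"
    "\<And>i x. dist (S i x) 0 \<le> 2 * dist (f x) 0"
    using borel_measurable_implies_sequence_metric[OF fm, of 0] by auto
  \<comment> \<open>Finite because \<open>padic_J m\<close> is; a pair \<open>(\<gamma>, s)\<close>
    with \<open>s\<close> in \<open>padic_J m\<close> belongs to \<open>G n\<close> from n =
    |\<gamma>| on.\<close>
  define G :: "nat \<Rightarrow> (int \<times> 'p padic) set" where "G n = {- int n..int n} \<times> padic_J m" for n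
  have finG: "finite (G n)" for n unfolding G_def using finite_padic_J[OF m] by auto
  let ?W = "\<lambda>(\<gamma>, s). padic_wavelet_ball \<gamma> s"
  have disj: "disjoint_family_on ?W (UNIV \<times> padic_J m)"
    using padic_wavelet_ball_unique[OF m] unfolding disjoint_family_on_def by fastforce
  define g where "g n x = S n x * indicator (\<Union>i\<in>G n. ?W i) x" for n x
  have g_eq: "g n x = (\<Sum>i\<in>G n. \<Sum>y\<in>range (S n). y * indicator (S n -` {y} \<inter> ?W i) x)" for n x
  proof -
    have 1: "(indicator (\<Union>i\<in>G n. ?W i) x :: complex) = (\<Sum>i\<in>G n. indicator (?W i) x)"
      by (rule indicator_UN_disjoint[OF finG]) (auto intro!: disjoint_family_on_mono[OF _ disj] simp: G_def)
    have 2: "S n x = (\<Sum>y\<in>range (S n). y * indicator (S n -` {y}) x)"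
      using S(1)[of n] by (subst sum.remove[of _ "S n x"]) (auto simp: simple_function_def indicator_def intro!: sum.neutral)
    have "g n x = (\<Sum>i\<in>G n. indicator (?W i) x) * (\<Sum>y\<in>range (S n). y * indicator (S n -` {y}) x)"
      unfolding g_def 1 2[symmetric] by (rule mult.commute)
    also have "\<dots> = (\<Sum>i\<in>G n. \<Sum>y\<in>range (S n). y * indicator (S n -` {y} \<inter> ?W i) x)"
      unfolding sum_product by (intro sum.cong refl) (simp add: indicator_inter_arith)
    finally show ?thesis .
  qed
  show ?thesis
  proof (rule L2_closed_span_dominated[OF square_integrable_family f, where K = 2])
    show "g n \<in> wavelet_closure" for n
    proof -
      have "(\<lambda>x. indicator (S n -` {y} \<inter> ?W i) x) \<in> wavelet_closure" if "i \<in> G n" for i y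
      proof -
        have "S n -` {y} \<in> sets borel"
          using simple_functionD(2)[OF S(1)[of n], of "{y}"] by simp
        then show ?thesis using indicator_closure that by (auto simp: G_def)
      qed
      then have "(\<lambda>x. \<Sum>i\<in>G n. \<Sum>y\<in>range (S n). y * indicator (S n -` {y} \<inter> ?W i) x) \<in> wavelet_closure"
        using simple_functionD(1)[OF S(1)[of n]]
        by (intro L2_closed_span_sum L2_closed_span_scale square_integrable_family finG) auto
      then show ?thesis unfolding g_eq .
    qed
    \<comment> \<open>Away from 0 the point lies in some wavelet ball, so the truncation eventually
      leaves the value of \<open>S n\<close> unchanged.\<close>
    have "AE x in M. x \<noteq> 0"
      using emeasure_zero by (intro AE_I[of _ _ "{0}"]) auto
    then show "AE x in M. (\<lambda>n. g n x) \<longlonglongrightarrow> f x"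
    proof eventually_elim
      case (elim x)
      then obtain \<gamma> s where W: "s \<in> padic_J m" "x \<in> padic_wavelet_ball \<gamma> s"
        using padic_wavelet_ball_covers[OF m] by blast
      have "g n x = S n x" if "n \<ge> nat \<bar>\<gamma>\<bar>" for n
      proof -
        have "(\<gamma>, s) \<in> G n" using that W(1) by (auto simp: G_def)
        then have "x \<in> (\<Union>i\<in>G n. ?W i)" using W(2) by blast
        then show ?thesis by (simp add: g_def)
      qed
      then have "eventually (\<lambda>n. S n x = g n x) sequentially"
        unfolding eventually_sequentially by metis
      then show ?case using S(2)[of x] by (rule Lim_transform_eventually[rotated])
    qed
    show "AE x in M. cmod (g n x) \<le> 2 * cmod (f x)" for n
      using S(3)[of n] by (auto simp: g_def indicator_def)
  qed
qed

lemma orthonormal_basis_wavelet: "L2_orthonormal_basis M (wavelet_index m) wavelet_family"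
  unfolding L2_orthonormal_basis_def
proof (intro conjI ballI allI impI)
  show "square_integrable M (wavelet_family i)" for i by (rule square_integrable_family)
  show "L2_inner M (wavelet_family i) (wavelet_family j) = (if i = j then 1 else 0)"
    if "i \<in> wavelet_index m" "j \<in> wavelet_index m" for i j
    using that L2_inner_wavelet[OF m] by (auto split: prod.splits)
  fix f :: "'p padic \<Rightarrow> complex" and \<epsilon> :: real
  assume "square_integrable M f" and e: "\<epsilon> > 0"
  then have "f \<in> wavelet_closure" by (intro wavelet_closure_complete)
  \<comment> \<open>\<open>L2_sq\<close> is the square of \<open>L2_norm\<close>, so the span is
    asked for an error below the square of \<epsilon>.\<close>
  moreover have "\<epsilon>\<^sup>2 > 0" using e by simp
  ultimately obtain h where h: "h \<in> lin_span (wavelet_index m) wavelet_family"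
      "L2_sq M (\<lambda>x. f x - h x) < \<epsilon>\<^sup>2"
    unfolding L2_closed_span_def by blast
  obtain F c where "h = (\<lambda>x. \<Sum>i\<in>F. c i * wavelet_family i x)" "finite F" "F \<subseteq> wavelet_index m"
    using h(1) unfolding lin_span_def by blast
  moreover have "L2_norm M (\<lambda>x. f x - h x) < \<epsilon>"
    unfolding L2_norm_def using h(2) e by (intro real_less_lsqrt) (auto simp: L2_sq_def)
  ultimately show "\<exists>F c. finite F \<and> F \<subseteq> wavelet_index m \<and>
     L2_norm M (\<lambda>x. f x - (\<Sum>i\<in>F. c i * wavelet_family i x)) < \<epsilon>" by blast
qed

end

end

theorem corollary5p1:
  fixes M :: "'p::prime_card padic measure" and m :: nat
  assumes "normalized_padic_haar M" and "m \<ge> 1"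
  shows "(\<forall>\<gamma>. \<forall>s\<in>padic_J m. \<forall>a\<in>padic_I. \<forall>\<xi>.
            padic_fourier M (padic_theta \<gamma> s a) \<xi> =
              of_real (real CARD('p) powr (real_of_int \<gamma> / 2)) *
              padic_char (of_nat CARD('p) powi (- \<gamma>) * a * \<xi>) *
              of_real (Omega (padic_norm (s + of_nat CARD('p) powi (- \<gamma>) * \<xi>)))) \<and>
         L2_orthonormal_basis M (UNIV \<times> padic_J m \<times> padic_I)
           (\<lambda>(\<gamma>, s, a). padic_fourier M (padic_theta \<gamma> s a))"
proof -
  interpret padic_haar M by standard (rule assms(1))
  have "padic_fourier M (padic_theta \<gamma> s a) = padic_wavelet \<gamma> s a" for \<gamma> s a
    by (rule ext) (rule fourier_theta)
  note eq = this
  show ?thesis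
    unfolding eq using orthonormal_basis_wavelet[OF assms(2)] by (blast intro: padic_wavelet_eq)
qed

end
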